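(* Let $n\ge4$ be even, let $F$ be an algebraically closed field of characteristic $0$, and let $L$ be any non-simple $(n+1)$-dimensional $n$-Lie algebra over $F$, presented with a basis $e_1,\dots,e_{n+1}$ in one of the normal forms (0), (1a), (1b), (2a), (2b), ($r$) with $3\le r\le n$ of Filippov's classification (listed in the context). Let $U(L)=F\langle x_1,\dots,x_{n+1}\rangle/I$ be its universal associative envelope. In cases (0), (1a), (2a) and ($r$), a basis of $U(L)$ consists of the (cosets of the) monomials which do not contain any factor of the form $$x_{i_1}x_{i_2}\cdots x_{i_n}\quad(i_1>i_2>\cdots>i_n).$$ In case (1b), a basis of $U(L)$ consists of the monomials which do not contain any factor of the form $$x_{n+1}x_1\qquad\text{or}\qquad x_{i_1}x_{i_2}\cdots x_{i_n}\quad(i_1>i_2>\cdots>i_n).$$ In case (2b), a basis of $U(L)$ consists of the monomials which do not contain any factor of the form $$x_2x_1,\qquad x_{n+1}x_n\cdots x_2,\qquad x_{n+1}x_n\cdots x_3x_1,\qquad x_{n+1}\cdots x_5x_2x_4x_1,$$ $$\text{or}\qquad x_{n+1}\cdots\widehat{x}_i\cdots x_4x_2x_3x_1\quad(4\le i\le n+1).$$ Hence in every case $U(L)$ is infinite-dimensional.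
   Context: An $n$-Lie algebra is a vector space over a field of characteristic $\neq2$ with a multilinear alternating operation $[z_1,\dots,z_n]$ (permuting arguments by $\sigma$ multiplies by the sign $\epsilon(\sigma)$) satisfying $[[z_1,\dots,z_n],w_2,\dots,w_n]=\sum_{i=1}^n[z_1,\dots,[z_i,w_2,\dots,w_n],\dots,z_n]$. It is simple if its bracket is nonzero and it has no ideals (subspaces $J$ with $[J,L,\dots,L]\subseteq J$) other than $0$ and $L$. A hat means the entry is omitted. Filippov's classification: over an algebraically closed field of characteristic $0$, every non-simple $(n+1)$-dimensional $n$-Lie algebra ($n\ge3$) has a basis $e_1,\dots,e_{n+1}$ for which exactly one of the following holds (brackets of basis elements not determined by the listed ones and the alternating property are zero): (0) all brackets are zero; (1a) $[e_2,\dots,e_{n+1}]=e_1$; (1b) $[e_1,\dots,e_n]=e_1$; (2a) $[e_2,\dots,e_{n+1}]=e_1$ and $[e_1,e_3,\dots,e_{n+1}]=e_2$; (2b) $[e_2,\dots,e_{n+1}]=e_1+\beta e_2$ with $\beta\in F\setminus\{0\}$ and $[e_1,e_3,\dots,e_{n+1}]=e_2$; ($r$) for some $3\le r\le n$, $[e_1,\dots,\widehat{e}_i,\dots,e_{n+1}]=e_i$ for $1\le i\le r$. Universal associative envelope: let $\phi\colon L\to F\langle x_1,\dots,x_{n+1}\rangle$ (free unital associative algebra) be linear with $\phi(e_i)=x_i$, let $y_i=\phi([e_1,\dots,\widehat{e}_i,\dots,e_{n+1}])$ and $\mathrm{alt}(z_1,\dots,z_n)=\sum_{\sigma\in S_n}\epsilon(\sigma)z_{\sigma(1)}\cdots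 z_{\sigma(n)}$. Let $I$ be the two-sided ideal generated by $G_i=(-1)^{\lfloor n/2\rfloor}\big(\mathrm{alt}(x_1,\dots,\widehat{x}_i,\dots,x_{n+1})-y_i\big)$, $1\le i\le n+1$. Then $U(L)=F\langle x_1,\dots,x_{n+1}\rangle/I$. Monomials are words in $x_1,\dots,x_{n+1}$ (including the empty word); a word $u$ is a factor of $v$ if $v=w_1uw_2$ for some words $w_1,w_2$. *)

theory Defs
  imports
    "HOL-Computational_Algebra.Polynomial"
    "HOL-Combinatorics.Permutations"
    "HOL-Library.Poly_Mapping"
    "HOL-Library.Sublist"
    "HOL-Algebra.QuotRing"
    "HOL-Algebra.Module"
    "Jordan_Normal_Form.VS_Connect"
begin

section \<open>n-Lie algebras\<close>

text \<open>
  The bracket of \<open>z\<^sub>1, \<dots>, z\<^sub>n\<close> is \<open>br [z\<^sub>1, \<dots>, z\<^sub>n]\<close>; its values on lists of other lengths are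
  irrelevant.  List positions are counted from 0.
\<close>

locale n_Lie_algebra = vector_space scale
  for scale :: "'a::field \<Rightarrow> 'l::ab_group_add \<Rightarrow> 'l" +
  fixes n :: nat and br :: "'l list \<Rightarrow> 'l"
  assumes char_not_2: "(2::'a) \<noteq> 0"
    and multilinear: "\<And>zs i. length zs = n \<Longrightarrow> i < n \<Longrightarrow>
          Vector_Spaces.linear scale scale (\<lambda>x. br (zs[i := x]))"
    and alternating: "\<And>zs \<sigma>. length zs = n \<Longrightarrow> \<sigma> permutes {..<n} \<Longrightarrow>
          br (permute_list \<sigma> zs) = scale (of_int (sign \<sigma>)) (br zs)"
    and jacobi: "\<And>zs ws. length zs = n \<Longrightarrow> length ws = n - 1 \<Longrightarrow>
          br (br zs # ws) = (\<Sum>i<n. br (zs[i := br (zs ! i # ws)]))"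
begin

definition is_ideal :: "'l set \<Rightarrow> bool" where
  "is_ideal J \<longleftrightarrow> subspace J \<and> (\<forall>x\<in>J. \<forall>ws. length ws = n - 1 \<longrightarrow> br (x # ws) \<in> J)"

definition simple :: bool where
  "simple \<longleftrightarrow> (\<exists>zs. length zs = n \<and> br zs \<noteq> 0) \<and> (\<forall>J. is_ideal J \<longrightarrow> J = {0} \<or> J = UNIV)"

text \<open>\<open>e 1, \<dots>, e (n + 1)\<close> is a basis; in particular the dimension is \<open>n + 1\<close>.\<close>

definition indexed_basis :: "(nat \<Rightarrow> 'l) \<Rightarrow> bool" where
  "indexed_basis e \<longleftrightarrow>
     inj_on e {1..n+1} \<and> independent (e ` {1..n+1}) \<and> span (e ` {1..n+1}) = UNIV"

end


section \<open>Filippov's normal forms\<close>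

definition omit :: "nat \<Rightarrow> nat \<Rightarrow> nat list" where
  "omit n i = filter (\<lambda>j. j \<noteq> i) [1..<n+2]"

text \<open>
  A bracket of \<open>n\<close> of the \<open>n + 1\<close> basis vectors either has a repeated entry, and then
  vanishes, or is up to sign the bracket of all of them but one \<open>e i\<close>, in increasing order.  So
  prescribing the latter for each \<open>i\<close> determines the whole operation.
\<close>

definition bracket_table :: "nat \<Rightarrow> ('l list \<Rightarrow> 'l) \<Rightarrow> (nat \<Rightarrow> 'l) \<Rightarrow> (nat \<Rightarrow> 'l) \<Rightarrow> bool" where
  "bracket_table n br e t \<longleftrightarrow> (\<forall>i\<in>{1..n+1}. br (map e (omit n i)) = t i)"

definition form_0 :: "nat \<Rightarrow> ('l::ab_group_add list \<Rightarrow> 'l) \<Rightarrow> (nat \<Rightarrow> 'l) \<Rightarrow> bool" where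
  "form_0 n br e \<longleftrightarrow> bracket_table n br e (\<lambda>i. 0)"

definition form_1a :: "nat \<Rightarrow> ('l::ab_group_add list \<Rightarrow> 'l) \<Rightarrow> (nat \<Rightarrow> 'l) \<Rightarrow> bool" where
  "form_1a n br e \<longleftrightarrow> bracket_table n br e (\<lambda>i. if i = 1 then e 1 else 0)"

definition form_1b :: "nat \<Rightarrow> ('l::ab_group_add list \<Rightarrow> 'l) \<Rightarrow> (nat \<Rightarrow> 'l) \<Rightarrow> bool" where
  "form_1b n br e \<longleftrightarrow> bracket_table n br e (\<lambda>i. if i = n + 1 then e 1 else 0)"

definition form_2a :: "nat \<Rightarrow> ('l::ab_group_add list \<Rightarrow> 'l) \<Rightarrow> (nat \<Rightarrow> 'l) \<Rightarrow> bool" where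
  "form_2a n br e \<longleftrightarrow>
     bracket_table n br e (\<lambda>i. if i = 1 then e 1 else if i = 2 then e 2 else 0)"

definition form_2b ::
  "('a::field \<Rightarrow> 'l::ab_group_add \<Rightarrow> 'l) \<Rightarrow> nat \<Rightarrow> ('l list \<Rightarrow> 'l) \<Rightarrow> (nat \<Rightarrow> 'l) \<Rightarrow> bool" where
  "form_2b scale n br e \<longleftrightarrow> (\<exists>\<beta>. \<beta> \<noteq> 0 \<and>
     bracket_table n br e
       (\<lambda>i. if i = 1 then e 1 + scale \<beta> (e 2) else if i = 2 then e 2 else 0))"

definition form_r :: "nat \<Rightarrow> ('l::ab_group_add list \<Rightarrow> 'l) \<Rightarrow> (nat \<Rightarrow> 'l) \<Rightarrow> nat \<Rightarrow> bool" where
  "form_r n br e r \<longleftrightarrow> bracket_table n br e (\<lambda>i. if i \<le> r then e i else 0)"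


section \<open>The free associative algebra\<close>

text \<open>
  Words in the letters \<open>x\<^sub>1, x\<^sub>2, \<dots>\<close> are lists of positive numbers.  With concatenation as the
  monoid operation on lists, the convolution product of \<^typ>\<open>nat list \<Rightarrow>\<^sub>0 'a\<close> is the product of
  noncommutative polynomials.
\<close>

instantiation list :: (type) monoid_add
begin

definition zero_list :: "'a list" where "zero_list = []"

definition plus_list :: "'a list \<Rightarrow> 'a list \<Rightarrow> 'a list" where "plus_list = (@)"

instance by standard (simp_all add: zero_list_def plus_list_def)

end

definition free_alg :: "nat \<Rightarrow> (nat list \<Rightarrow>\<^sub>0 'a::field) ring" where
  "free_alg m =
     \<lparr>carrier = {p. \<forall>w\<in>Poly_Mapping.keys p. set w \<subseteq> {1..m}},
      monoid.mult = (*), one = 1, zero = 0, add = (+)\<rparr>"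

definition mon :: "nat list \<Rightarrow> (nat list \<Rightarrow>\<^sub>0 'a::field)" where
  "mon w = Poly_Mapping.single w 1"

definition const :: "'a \<Rightarrow> (nat list \<Rightarrow>\<^sub>0 'a::field)" where
  "const c = Poly_Mapping.single [] c"

definition alt :: "'b::ring_1 list \<Rightarrow> 'b" where
  "alt zs = (\<Sum>\<sigma> | \<sigma> permutes {..<length zs}. of_int (sign \<sigma>) * prod_list (permute_list \<sigma> zs))"


section \<open>The universal associative envelope\<close>

text \<open>The linear map with \<open>e i \<mapsto> x\<^sub>i\<close> for a basis \<open>e 1, \<dots>, e (n + 1)\<close>; \<open>representation\<close> yields the coordinates.\<close>

definition phi :: "('a::field \<Rightarrow> 'l::ab_group_add \<Rightarrow> 'l) \<Rightarrow> nat \<Rightarrow> (nat \<Rightarrow> 'l) \<Rightarrow> 'l \<Rightarrow> (nat list \<Rightarrow>\<^sub>0 'a)"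
  where "phi scale n e v =
    (\<Sum>i=1..n+1. const (Modules.module.representation scale (e ` {1..n+1}) v (e i)) * mon [i])"

definition env_gen :: "('a::field \<Rightarrow> 'l::ab_group_add \<Rightarrow> 'l) \<Rightarrow> nat \<Rightarrow> ('l list \<Rightarrow> 'l) \<Rightarrow> (nat \<Rightarrow> 'l) \<Rightarrow>
    nat \<Rightarrow> (nat list \<Rightarrow>\<^sub>0 'a)" where
  "env_gen scale n br e i =
     (- 1) ^ (n div 2) *
       (alt (map (\<lambda>j. mon [j]) (omit n i)) - phi scale n e (br (map e (omit n i))))"

text \<open>
  The ring ideal generated is also the algebra ideal generated, as the constants lie in the free
  algebra.
\<close>

definition env_ideal :: "('a::field \<Rightarrow> 'l::ab_group_add \<Rightarrow> 'l) \<Rightarrow> nat \<Rightarrow> ('l list \<Rightarrow> 'l) \<Rightarrow> (nat \<Rightarrow> 'l) \<Rightarrow>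
    (nat list \<Rightarrow>\<^sub>0 'a) set" where
  "env_ideal scale n br e = genideal (free_alg (n+1)) (env_gen scale n br e ` {1..n+1})"

definition mon_coset :: "('a::field \<Rightarrow> 'l::ab_group_add \<Rightarrow> 'l) \<Rightarrow> nat \<Rightarrow> ('l list \<Rightarrow> 'l) \<Rightarrow> (nat \<Rightarrow> 'l) \<Rightarrow>
    nat list \<Rightarrow> (nat list \<Rightarrow>\<^sub>0 'a) set" where
  "mon_coset scale n br e w = env_ideal scale n br e +>\<^bsub>free_alg (n+1)\<^esub> mon w"

definition envelope :: "('a::field \<Rightarrow> 'l::ab_group_add \<Rightarrow> 'l) \<Rightarrow> nat \<Rightarrow> ('l list \<Rightarrow> 'l) \<Rightarrow> (nat \<Rightarrow> 'l) \<Rightarrow>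
    ('a, (nat list \<Rightarrow>\<^sub>0 'a) set) module" where
  "envelope scale n br e =
     (let R = free_alg (n+1); I = env_ideal scale n br e; Q = R Quot I in
      \<lparr>carrier = carrier Q, monoid.mult = monoid.mult Q, one = one Q, zero = zero Q, add = add Q,
       smult = (\<lambda>c A. (I +>\<^bsub>R\<^esub> const c) \<otimes>\<^bsub>Q\<^esub> A)\<rparr>)"

text \<open>The cosets of the words in \<open>W\<close> are pairwise distinct and form a basis.\<close>

definition monomial_basis :: "('a::field \<Rightarrow> 'l::ab_group_add \<Rightarrow> 'l) \<Rightarrow> nat \<Rightarrow> ('l list \<Rightarrow> 'l) \<Rightarrow>
    (nat \<Rightarrow> 'l) \<Rightarrow> nat list set \<Rightarrow> bool" where
  "monomial_basis scale n br e W \<longleftrightarrow>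
     inj_on (mon_coset scale n br e) W \<and>
     vectorspace.basis class_ring (envelope scale n br e) (mon_coset scale n br e ` W)"


section \<open>Forbidden factors\<close>

definition avoiding :: "nat \<Rightarrow> nat list set \<Rightarrow> nat list set" where
  "avoiding n S = {w. set w \<subseteq> {1..n+1} \<and> (\<forall>u\<in>S. \<not> sublist u w)}"

definition descending :: "nat \<Rightarrow> nat list set" where
  "descending n = {w. length w = n \<and> set w \<subseteq> {1..n+1} \<and> sorted_wrt (>) w}"

definition forbidden_1b :: "nat \<Rightarrow> nat list set" where
  "forbidden_1b n = {[n+1, 1]} \<union> descending n"

definition forbidden_2b :: "nat \<Rightarrow> nat list set" where
  "forbidden_2b n =
     {[2, 1], rev [2..<n+2], rev [3..<n+2] @ [1], rev [5..<n+2] @ [2, 4, 1]} \<union>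
     (\<lambda>i. rev (filter (\<lambda>j. j \<noteq> i) [4..<n+2]) @ [2, 3, 1]) ` {4..n+1}"

end

theory Submission
  imports Defs "HOL-Combinatorics.Multiset_Permutations"
begin

text \<open>
  In each case the words listed are those without a factor among the leading words of a Groebner
  basis of the defining ideal, for the degree-lexicographic order. That such words form a basis of
  the quotient is Bergman's diamond lemma (\<open>normal_eq_zero_if_multiple\<close>, \<open>normal_words_span\<close>): it
  suffices that wherever two leading words overlap, the two ways of reducing the common word
  differ by multiples of basis elements with smaller leading words.

  The leading word of \<open>G\<^sub>i\<close> is the descending word in all letters except \<open>x\<^sub>i\<close>, and the sign
  \<open>(-1) ^ (n div 2)\<close> makes its coefficient 1. If two such words overlap, then their union is
  descending, hence is the word \<open>W = x\<^sub>n\<^sub>+\<^sub>1 \<dots> x\<^sub>1\<close> in all letters; so the only composition is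
  \<open>G\<^sub>1 x\<^sub>1 - x\<^sub>n\<^sub>+\<^sub>1 G\<^sub>n\<^sub>+\<^sub>1\<close>. Expanding the alternating sum of all \<open>n + 1\<close> letters along the first
  and along the last letter gives, for even \<open>n\<close>, the identity \<open>\<Sum> (-1)\<^sup>i [x\<^sub>i, alt\<^sub>i] = 0\<close>, where
  \<open>alt\<^sub>i\<close> is the alternating sum without \<open>x\<^sub>i\<close> (\<open>alt_sum_commutators\<close>). Therefore
  \<open>\<Sum> (-1)\<^sup>i [x\<^sub>i, G\<^sub>i]\<close> equals \<open>\<Sum> (-1)\<^sup>i [x\<^sub>i, y\<^sub>i]\<close> up to sign. All the products \<open>x\<^sub>i G\<^sub>i\<close> and
  \<open>G\<^sub>i x\<^sub>i\<close> but the two in the composition have as leading words arrangements of the letters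
  other than \<open>W\<close>, which are smaller than \<open>W\<close>. So the composition resolves up to the obstruction
  \<open>\<Sum> (-1)\<^sup>i [x\<^sub>i, y\<^sub>i]\<close>, which lies in the ideal (\<open>composition_in_subspace\<close>,
  \<open>commutators_multiple\<close>).

  In the cases (0), (1a), (2a) and (r) every \<open>y\<^sub>i\<close> is 0 or \<open>x\<^sub>i\<close>, the obstruction vanishes, and the
  \<open>G\<^sub>i\<close> are a Groebner basis. In case (1b) the obstruction is \<open>[x\<^sub>n\<^sub>+\<^sub>1, x\<^sub>1]\<close> up to sign; its
  leading word overlaps with no other, and adding it suffices (\<open>descending_system\<close>). In case (2b)
  it is \<open>\<beta> [x\<^sub>2, x\<^sub>1]\<close>, and \<open>x\<^sub>2 x\<^sub>1\<close> is a factor of the leading words of all \<open>G\<^sub>i\<close> with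
  \<open>i \<ge> 3\<close>. Modulo \<open>x\<^sub>2 x\<^sub>1 = x\<^sub>1 x\<^sub>2\<close> the terms of \<open>G\<^sub>i\<close> with \<open>x\<^sub>1\<close> and \<open>x\<^sub>2\<close> adjacent cancel in
  pairs, which leaves the leading words named in the theorem; the only remaining overlap is that
  of \<open>x\<^sub>n\<^sub>+\<^sub>1 \<dots> x\<^sub>2\<close> with \<open>x\<^sub>2 x\<^sub>1\<close>, and the same identity resolves it (\<open>overlap_2b\<close>,
  \<open>system_2b\<close>).

  The powers of \<open>x\<^sub>1\<close> avoid all the forbidden factors, so the envelope is infinite-dimensional.
\<close>


section \<open>Noncommutative polynomials as a vector space\<close>

lemma mon_mult: "mon u * mon v = mon (u @ v)"
  by (simp add: mon_def mult_single plus_list_def)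

lemma mon_Nil: "mon [] = 1"
  by (simp add: mon_def zero_list_def[symmetric])

lemma const_mult_mon: "const c * mon w = Poly_Mapping.single w c"
  by (simp add: const_def mon_def mult_single plus_list_def)

lemma poly_expand:
  "p = (\<Sum>w\<in>Poly_Mapping.keys p. const (Poly_Mapping.lookup p w) * mon w)"
proof (rule poly_mapping_eqI)
  fix v
  have "(\<Sum>w\<in>Poly_Mapping.keys p. Poly_Mapping.lookup (const (Poly_Mapping.lookup p w) * mon w) v)
      = (\<Sum>w\<in>Poly_Mapping.keys p. if v = w then Poly_Mapping.lookup p w else 0)"
    by (intro sum.cong refl) (auto simp: const_mult_mon lookup_single when_def)
  then show "Poly_Mapping.lookup p v = Poly_Mapping.lookup
      (\<Sum>w\<in>Poly_Mapping.keys p. const (Poly_Mapping.lookup p w) * mon w) v"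
    by (simp add: lookup_sum in_keys_iff)
qed

lemma const_commute: "const c * p = p * const c"
proof -
  have "const c * (const d * mon w) = (const d * mon w) * const c" for d w
    by (simp add: const_mult_mon) (simp add: const_def mult_single plus_list_def mult.commute)
  then show ?thesis
    by (subst (1 2) poly_expand[of p]) (simp add: sum_distrib_left sum_distrib_right)
qed

lemma const_hom: "const (c + d) = const c + const d" "const (c * d) = const c * const d"
  "const 1 = 1" "const 0 = 0" "const (- c) = - const c"
  by (simp_all add: const_def single_add mult_single single_uminus flip: zero_list_def)

text \<open>
  The type-class theory of spans and subspaces applies to noncommutative polynomials once
  multiplication by constants is seen as a scalar multiplication.
\<close>

definition scl :: "'a::field \<Rightarrow> (nat list \<Rightarrow>\<^sub>0 'a) \<Rightarrow> (nat list \<Rightarrow>\<^sub>0 'a)" where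
  "scl c p = const c * p"

interpretation P: vector_space "scl :: 'a::field \<Rightarrow> _"
  by standard (simp_all add: scl_def const_hom algebra_simps)

lemma mult_scl: "p * scl c q = scl c (p * q)" "scl c p * q = scl c (p * q)"
  by (simp_all add: scl_def mult.assoc const_commute[of c])

lemma lookup_scl: "Poly_Mapping.lookup (scl c p) w = c * Poly_Mapping.lookup p w"
proof -
  have "scl c p = Poly_Mapping.map ((*) c) p"
    unfolding scl_def const_def mult_map_scale_conv_mult zero_list_def by simp
  then show ?thesis by (simp add: Poly_Mapping.map.rep_eq when_def)
qed

lemma in_span_mon:
  assumes "Poly_Mapping.keys p \<subseteq> W" shows "p \<in> P.span (mon ` W)"
proof (subst poly_expand, unfold scl_def[symmetric])
  show "(\<Sum>w\<in>Poly_Mapping.keys p. scl (Poly_Mapping.lookup p w) (mon w)) \<in> P.span (mon ` W)"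
    using assms by (intro P.span_sum P.span_scale P.span_base) blast
qed

lemma keys_in_span_mon:
  assumes "p \<in> P.span (mon ` W)" shows "Poly_Mapping.keys p \<subseteq> W"
proof -
  have "\<forall>w. w \<notin> W \<longrightarrow> Poly_Mapping.lookup p w = 0"
    using assms
  proof (induction rule: P.span_induct)
    case base
    show ?case by (auto simp: P.subspace_def lookup_add lookup_scl)
  next
    case (step p)
    then show ?case by (auto simp: mon_def lookup_single when_def)
  qed
  then show ?thesis by (auto simp: in_keys_iff)
qed

text \<open>
  Since \<open>x \<mapsto> p * x * q\<close> is linear, membership of its values in a span can be tested on
  generators.
\<close>

lemma sandwich_span:
  assumes f: "f \<in> P.span B" and B: "\<And>x. x \<in> B \<Longrightarrow> p * x * q \<in> P.span C"
  shows "p * f * q \<in> P.span C"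
  using f
proof (induction rule: P.span_induct)
  case base
  show ?case
    by (auto simp: P.subspace_def algebra_simps mult_scl P.span_zero P.span_add P.span_scale)
next
  case (step x) then show ?case by (rule B)
qed


section \<open>The degree-lexicographic order\<close>

text \<open>
  Words are compared by length first, and lexicographically with \<open>x\<^sub>1 < x\<^sub>2 < \<dots>\<close> if the lengths
  agree.
\<close>

definition word_less :: "nat list \<Rightarrow> nat list \<Rightarrow> bool" (infix "\<prec>" 50) where
  "u \<prec> v \<longleftrightarrow> (u, v) \<in> lenlex less_than"

lemma wf_word_less: "wfP (\<prec>)"
  using wf_lenlex[OF wf_less_than] by (simp add: wfp_def word_less_def)

lemma word_less_trans: "u \<prec> v \<Longrightarrow> v \<prec> w \<Longrightarrow> u \<prec> w"
  unfolding word_less_def by (rule lenlex_trans) simp_all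

lemma word_less_irrefl: "\<not> u \<prec> u"
  by (simp add: word_less_def lenlex_irreflexive)

lemma word_less_linear: "u \<prec> v \<or> u = v \<or> v \<prec> u"
  using total_lenlex[OF total_less_than] by (auto simp: word_less_def total_on_def)

lemma word_less_context: "u \<prec> v \<Longrightarrow> a @ u @ b \<prec> a @ v @ b"
  by (simp add: word_less_def lenlex_append1 irrefl_less_than)


section \<open>The diamond lemma\<close>

text \<open>
  \<open>S\<close> is to be the set of leading words of the relations, and \<open>g u\<close> the relation with leading word
  \<open>u\<close>.
\<close>

locale word_system =
  fixes S :: "nat list set" and g :: "nat list \<Rightarrow> (nat list \<Rightarrow>\<^sub>0 'a::field)"
begin

text \<open>
  The combinations of multiples \<open>a g(u) b\<close> whose leading words \<open>a u b\<close> stay strictly below \<open>W\<close>. A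
  difference of two multiples with the common leading word \<open>W\<close> is harmless if it lies here.
\<close>

definition lower :: "nat list \<Rightarrow> (nat list \<Rightarrow>\<^sub>0 'a) set" where
  "lower W = P.span {mon a * g u * mon b | a b u. u \<in> S \<and> a @ u @ b \<prec> W}"

lemma lower_mono: "v = w \<or> v \<prec> w \<Longrightarrow> lower v \<subseteq> lower w"
proof -
  assume *: "v = w \<or> v \<prec> w"
  then have "a @ u @ b \<prec> w" if "a @ u @ b \<prec> v" for a u b
    using that word_less_trans by metis
  then show ?thesis unfolding lower_def by (intro P.span_mono Collect_mono) metis
qed

lemma lower_base: "u \<in> S \<Longrightarrow> a @ u @ b \<prec> W \<Longrightarrow> mon a * g u * mon b \<in> lower W"
  unfolding lower_def by (intro P.span_base) blast

lemma lower_context: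
  assumes "f \<in> lower w" shows "mon a * f * mon b \<in> lower (a @ w @ b)"
  using assms unfolding lower_def
proof (rule sandwich_span)
  fix x assume "x \<in> {mon a * g u * mon b | a b u. u \<in> S \<and> a @ u @ b \<prec> w}"
  then obtain c d u where x: "x = mon c * g u * mon d" "u \<in> S" "c @ u @ d \<prec> w" by blast
  have "mon a * x * mon b = mon (a @ c) * g u * mon (d @ b)"
    unfolding x(1) mon_mult[symmetric] by (simp only: mult.assoc)
  moreover have "(a @ c) @ u @ (d @ b) \<prec> a @ w @ b"
    using word_less_context[OF x(3), of a b] by simp
  ultimately show "mon a * x * mon b \<in> P.span {mon a' * g u * mon b' | a' b' u. u \<in> S \<and> a' @ u @ b' \<prec> a @ w @ b}"
    using x(2) by (intro P.span_base) blast
qed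

lemma lower_sandwich_poly:
  assumes "u \<in> S" "\<And>v. v \<in> Poly_Mapping.keys t \<Longrightarrow> a @ u @ m @ v @ b \<prec> W"
  shows "mon a * g u * mon m * t * mon b \<in> lower W"
proof -
  have "(mon a * g u * mon m) * t * mon b \<in> lower W"
    unfolding lower_def
  proof (rule sandwich_span[OF in_span_mon[OF subset_refl]])
    fix x :: "nat list \<Rightarrow>\<^sub>0 'a" assume "x \<in> mon ` Poly_Mapping.keys t"
    then obtain v where "x = mon v" "v \<in> Poly_Mapping.keys t" by blast
    with assms(2)[of v] lower_base[OF assms(1), of a "m @ v @ b" W]
    show "mon a * g u * mon m * x * mon b \<in> P.span {mon a * g u * mon b |a b u. u \<in> S \<and> a @ u @ b \<prec> W}"
      unfolding lower_def by (simp add: mon_mult[symmetric] mult.assoc)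
  qed
  then show ?thesis .
qed

lemma lower_poly_sandwich:
  assumes "u \<in> S" "\<And>v. v \<in> Poly_Mapping.keys t \<Longrightarrow> a @ v @ m @ u @ b \<prec> W"
  shows "mon a * t * mon m * g u * mon b \<in> lower W"
proof -
  have "mon a * t * (mon m * g u * mon b) \<in> lower W"
    unfolding lower_def
  proof (rule sandwich_span[OF in_span_mon[OF subset_refl]])
    fix x :: "nat list \<Rightarrow>\<^sub>0 'a" assume "x \<in> mon ` Poly_Mapping.keys t"
    then obtain v where "x = mon v" "v \<in> Poly_Mapping.keys t" by blast
    with assms(2)[of v] lower_base[OF assms(1), of "a @ v @ m" b W]
    show "mon a * x * (mon m * g u * mon b) \<in> P.span {mon a * g u * mon b |a b u. u \<in> S \<and> a @ u @ b \<prec> W}"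
      unfolding lower_def by (simp add: mon_mult[symmetric] mult.assoc)
  qed
  then show ?thesis by (simp add: mult.assoc)
qed

end

text \<open>
  By \<open>factor_free\<close> no leading word occurs inside another one, so proper overlaps are the only
  ambiguities; \<open>overlap\<close> says that they resolve.
\<close>

locale confluent_word_system = word_system S g
  for S :: "nat list set" and g :: "nat list \<Rightarrow> (nat list \<Rightarrow>\<^sub>0 'a::field)" +
  assumes leading: "u \<in> S \<Longrightarrow> v \<in> Poly_Mapping.keys (g u - mon u) \<Longrightarrow> v \<prec> u"
    and factor_free: "u \<in> S \<Longrightarrow> v \<in> S \<Longrightarrow> sublist v u \<Longrightarrow> v = u"
    and overlap: "p @ y \<in> S \<Longrightarrow> y @ z \<in> S \<Longrightarrow> p \<noteq> [] \<Longrightarrow> y \<noteq> [] \<Longrightarrow> z \<noteq> [] \<Longrightarrow>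
      g (p @ y) * mon z - mon p * g (y @ z) \<in> lower (p @ y @ z)"
begin

text \<open>
  The two occurrences can be disjoint, nested, or properly overlapping. Disjoint ones can be reduced
  independently of each other, nested ones coincide by \<open>factor_free\<close>, and properly overlapping ones
  are covered by the assumption \<open>overlap\<close>, put in context.
\<close>

lemma occurrences_agree_aux:
  assumes u: "u \<in> S" and v: "v \<in> S" and eq: "a @ u @ b = c @ v @ d" and le: "length a \<le> length c"
  shows "mon a * g u * mon b - mon c * g v * mon d \<in> lower (a @ u @ b)"
proof -
  define p where "p = drop (length a) c"
  have "take (length a) (a @ u @ b) = take (length a) (c @ v @ d)" using eq by simp
  then have "a = take (length a) c" using le by simp
  then have c: "c = a @ p" unfolding p_def by (metis append_take_drop_id)
  with eq have ub: "u @ b = p @ v @ d" by simp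
  from ub obtain y where "u = p @ y \<and> y @ b = v @ d \<or> u @ y = p \<and> b = y @ v @ d"
    unfolding append_eq_append_conv2 by blast
  then consider (disjoint) m where "p = u @ m" "b = m @ v @ d"
    | (meet) y where "u = p @ y" "y @ b = v @ d" "y \<noteq> []"
    by (cases "y = []") auto
  then show ?thesis
  proof cases
    case disjoint
    define s t where "s = g u - mon u" and "t = g v - mon v"
    \<comment> \<open>Both multiples are compared with the one in which \<open>u\<close> and \<open>v\<close> are replaced at the same time.\<close>
    have "mon a * g u * mon b - mon c * g v * mon d
        = mon a * s * mon m * g v * mon d - mon a * g u * mon m * t * mon d"
      unfolding c disjoint s_def t_def mon_mult[symmetric] by (simp add: algebra_simps)
    moreover have "mon a * s * mon m * g v * mon d \<in> lower (a @ u @ b)"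
      using leading[OF u] word_less_context[of _ u a "m @ v @ d"] v
      by (intro lower_poly_sandwich) (auto simp: s_def disjoint)
    moreover have "mon a * g u * mon m * t * mon d \<in> lower (a @ u @ b)"
      using leading[OF v] word_less_context[of _ v "a @ u @ m" d] u
      by (intro lower_sandwich_poly) (auto simp: t_def disjoint)
    ultimately show ?thesis
      unfolding lower_def by (simp add: P.span_diff)
  next
    case meet
    have nested: ?thesis if "v = u" "p = []" "b = d"
      using that by (simp add: c lower_def P.span_zero)
    from meet(2) consider (inside) m where "y = v @ m" "d = m @ b"
      | (overlapping) z where "v = y @ z" "b = z @ d"
      by (auto simp: append_eq_append_conv2)
    then show ?thesis
    proof cases
      case inside
      then have u_eq: "u = p @ v @ m" using meet by simp
      then have "v = u" using factor_free u v by (metis sublist_appendI)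
      with arg_cong[OF u_eq, of length] have "p = []" "m = []" by simp_all
      with \<open>v = u\<close> inside show ?thesis by (intro nested) simp_all
    next
      case overlapping
      show ?thesis
      proof (cases "p = [] \<or> z = []")
        case False
        have "mon a * (g u * mon z - mon p * g v) * mon d \<in> lower (a @ (p @ y @ z) @ d)"
          using lower_context[OF overlap[of p y z]] False u v meet overlapping by simp
        then show ?thesis
          by (simp add: c overlapping meet mon_mult[symmetric] algebra_simps)
      next
        case True
        then have "v = u"
          using meet overlapping factor_free[OF u v] factor_free[OF v u]
          by (metis append_Nil append_Nil2 prefix_imp_sublist prefixI sublist_appendI)
        with True meet overlapping show ?thesis by (intro nested) auto
      qed
    qed
  qed
qed

lemma occurrences_agree:
  assumes "u \<in> S" "v \<in> S" "a @ u @ b = c @ v @ d"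
  shows "mon a * g u * mon b - mon c * g v * mon d \<in> lower (a @ u @ b)"
proof (cases "length a \<le> length c")
  case True
  then show ?thesis using occurrences_agree_aux assms by blast
next
  case False
  then have "mon c * g v * mon d - mon a * g u * mon b \<in> lower (c @ v @ d)"
    using occurrences_agree_aux[OF assms(2,1) assms(3)[symmetric]] by simp
  then have "- (mon c * g v * mon d - mon a * g u * mon b) \<in> lower (c @ v @ d)"
    unfolding lower_def by (rule P.span_neg)
  then show ?thesis by (simp add: assms(3))
qed

lemma keys_multiple:
  assumes "u \<in> S" "w \<in> Poly_Mapping.keys (mon a * g u * mon b - mon (a @ u @ b))"
  shows "w \<prec> a @ u @ b"
proof -
  have "mon a * (g u - mon u) * mon b \<in> P.span (mon ` {w. w \<prec> a @ u @ b})"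
  proof (rule sandwich_span[OF in_span_mon[OF subset_refl]])
    fix x :: "nat list \<Rightarrow>\<^sub>0 'a" assume "x \<in> mon ` Poly_Mapping.keys (g u - mon u)"
    then obtain v where "x = mon v" "v \<prec> u" using leading[OF assms(1)] by blast
    then show "mon a * x * mon b \<in> P.span (mon ` {w. w \<prec> a @ u @ b})"
      using word_less_context[of v u a b]
      by (intro P.span_base) (auto simp: mon_mult)
  qed
  then have "mon a * g u * mon b - mon (a @ u @ b) \<in> P.span (mon ` {w. w \<prec> a @ u @ b})"
    by (simp add: algebra_simps mon_mult)
  then show ?thesis using keys_in_span_mon assms(2) by blast
qed

lemma lookup_multiple:
  assumes "u \<in> S" "w = a @ u @ b \<or> \<not> w \<prec> a @ u @ b"
  shows "Poly_Mapping.lookup (mon a * g u * mon b) w = (if w = a @ u @ b then 1 else 0)"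
proof -
  have "Poly_Mapping.lookup (mon a * g u * mon b - mon (a @ u @ b)) w = 0"
    using keys_multiple[OF assms(1), of w a b] assms(2) word_less_irrefl by (auto simp: in_keys_iff)
  then show ?thesis by (simp add: lookup_minus mon_def lookup_single when_def split: if_splits)
qed

lemma lookup_lower:
  assumes "f \<in> lower w" shows "Poly_Mapping.lookup f w = 0"
  using assms unfolding lower_def
proof (induction rule: P.span_induct)
  case base
  show ?case by (auto simp: P.subspace_def lookup_add lookup_scl)
next
  case (step x)
  then obtain a b u where "x = mon a * g u * mon b" "u \<in> S" "a @ u @ b \<prec> w" by blast
  then show ?case
    using lookup_multiple[of u w a b] word_less_trans word_less_irrefl by metis
qed

text \<open>
  Multiples with the same leading word agree up to smaller ones by \<open>occurrences_agree\<close>. Hence in a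
  linear combination all those with the largest leading word merge into a single one.
\<close>

lemma lower_leading_term:
  assumes "f \<in> lower w"
  shows "f = 0 \<or> (\<exists>a u b c. u \<in> S \<and> a @ u @ b \<prec> w \<and>
    f - scl c (mon a * g u * mon b) \<in> lower (a @ u @ b))"
  using assms unfolding lower_def
proof (induction rule: P.span_induct_alt)
  case base
  show ?case by simp
next
  case (step c x f)
  then obtain a b u where x: "x = mon a * g u * mon b" "u \<in> S" "a @ u @ b \<prec> w" by blast
  from step.IH show ?case
  proof (elim disjE exE conjE)
    assume "f = 0"
    with x show ?thesis
      by (intro disjI2 exI[of _ a] exI[of _ u] exI[of _ b] exI[of _ c]) (simp add: P.span_zero)
  next
    fix a' u' b' c'
    assume h: "u' \<in> S" "a' @ u' @ b' \<prec> w" and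
      "f - scl c' (mon a' * g u' * mon b') \<in> P.span {mon a * g u * mon b |a b u. u \<in> S \<and> a @ u @ b \<prec> a' @ u' @ b'}"
    then have f: "f - scl c' (mon a' * g u' * mon b') \<in> lower (a' @ u' @ b')"
      by (simp add: lower_def)
    let ?x' = "mon a' * g u' * mon b'"
    have "\<exists>a u b d. u \<in> S \<and> a @ u @ b \<prec> w \<and> scl c x + f - scl d (mon a * g u * mon b) \<in> lower (a @ u @ b)"
      using word_less_linear[of "a @ u @ b" "a' @ u' @ b'"]
    proof (elim disjE)
      assume less: "a @ u @ b \<prec> a' @ u' @ b'"
      have "scl c x + (f - scl c' ?x') \<in> lower (a' @ u' @ b')"
        using f lower_base[OF x(2) less] unfolding lower_def x(1)
        by (simp add: P.span_add P.span_scale)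
      then have "scl c x + f - scl c' ?x' \<in> lower (a' @ u' @ b')" by (simp only: add_diff_eq)
      with h show ?thesis by blast
    next
      assume eq: "a @ u @ b = a' @ u' @ b'"
      have "scl c (x - ?x') + (f - scl c' ?x') \<in> lower (a' @ u' @ b')"
        using f occurrences_agree[OF x(2) h(1) eq] unfolding lower_def x(1) eq
        by (simp add: P.span_add P.span_scale)
      also have "scl c (x - ?x') + (f - scl c' ?x') = scl c x + f - scl (c + c') ?x'"
        by (simp add: P.scale_left_distrib P.scale_right_diff_distrib)
      finally show ?thesis using h by blast
    next
      assume less: "a' @ u' @ b' \<prec> a @ u @ b"
      have "(f - scl c' ?x') + scl c' ?x' \<in> lower (a @ u @ b)"
        using lower_mono[of "a' @ u' @ b'" "a @ u @ b"] f lower_base[OF h(1) less] less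
        unfolding lower_def by (intro P.span_add P.span_scale) auto
      then have "scl c x + f - scl c (mon a * g u * mon b) \<in> lower (a @ u @ b)"
        by (simp add: x(1))
      with x show ?thesis by blast
    qed
    then show ?thesis by (simp add: lower_def)
  qed
qed

text \<open>
  The word of the topmost multiple in \<open>f\<close> contains an element of \<open>S\<close>, and its coefficient in \<open>f\<close> is
  the coefficient \<open>c\<close> of that multiple. If only normal words occur in \<open>f\<close>, then \<open>c = 0\<close> and \<open>f\<close>
  lies already in the span of multiples with smaller leading words; the order is well-founded.
\<close>

lemma normal_eq_zero_if_lower:
  assumes "f \<in> lower w" and "\<And>v. v \<in> Poly_Mapping.keys f \<Longrightarrow> \<forall>u\<in>S. \<not> sublist u v"
  shows "f = 0"
  using assms
proof (induction w arbitrary: rule: wfp_induct_rule[OF wf_word_less])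
  case (1 w)
  show ?case
  proof (cases "f = 0")
    case False
    then obtain a u b c where h: "u \<in> S" "a @ u @ b \<prec> w"
      and l: "f - scl c (mon a * g u * mon b) \<in> lower (a @ u @ b)"
      using lower_leading_term[OF 1(2)] by blast
    have "a @ u @ b \<notin> Poly_Mapping.keys f" using 1(3) h(1) sublist_appendI by blast
    then have "c = 0"
      using lookup_lower[OF l] lookup_multiple[OF h(1), of "a @ u @ b" a b]
      by (simp add: lookup_minus lookup_scl in_keys_iff)
    then have "f \<in> lower (a @ u @ b)" using l by simp
    then show ?thesis using 1(1)[OF h(2)] 1(3) by blast
  qed
qed

end

text \<open>
  The two-sided ideal generated by \<open>G\<close> in the free algebra over the letters \<open>X\<close>, as a linear
  span.
\<close>

definition multiples :: "nat set \<Rightarrow> (nat list \<Rightarrow>\<^sub>0 'a::field) set \<Rightarrow> (nat list \<Rightarrow>\<^sub>0 'a) set" where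
  "multiples X G = P.span {mon a * f * mon b | a b f. set a \<subseteq> X \<and> set b \<subseteq> X \<and> f \<in> G}"

lemma multiples_base:
  "f \<in> G \<Longrightarrow> set a \<subseteq> X \<Longrightarrow> set b \<subseteq> X \<Longrightarrow> mon a * f * mon b \<in> multiples X G"
  unfolding multiples_def by (intro P.span_base) blast

lemma (in confluent_word_system) normal_eq_zero_if_multiple:
  assumes "f \<in> multiples X (g ` S)" "\<And>v. v \<in> Poly_Mapping.keys f \<Longrightarrow> \<forall>u\<in>S. \<not> sublist u v"
  shows "f = 0"
proof -
  have "\<exists>w. f \<in> lower w"
    using assms(1) unfolding multiples_def
  proof (induction rule: P.span_induct_alt)
    case base
    show ?case by (auto simp: lower_def P.span_zero)
  next
    case (step c x f)
    then obtain a b u w where x: "x = mon a * g u * mon b" "u \<in> S" and f: "f \<in> lower w" by blast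
    \<comment> \<open>A word longer than all words in sight lies above them.\<close>
    define v where "v = replicate (Suc (length (a @ u @ b) + length w)) (0::nat)"
    have "a @ u @ b \<prec> v" "w \<prec> v" by (auto simp: v_def word_less_def lenlex_conv)
    then have "x \<in> lower v" "f \<in> lower v"
      using lower_base x f lower_mono by blast+
    then have "scl c x + f \<in> lower v" unfolding lower_def by (simp add: P.span_add P.span_scale)
    then show ?case by blast
  qed
  then show ?thesis using normal_eq_zero_if_lower assms(2) by blast
qed

text \<open>
  Replacing a factor \<open>u \<in> S\<close> of a word by the tail of its relation only produces smaller words,
  still over the letters \<open>X\<close>; by well-foundedness this ends with normal words.
\<close>

lemma normal_words_span:
  assumes lead: "\<And>u v. u \<in> S \<Longrightarrow> v \<in> Poly_Mapping.keys (g u - mon u) \<Longrightarrow> v \<prec> u \<and> set v \<subseteq> X"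
    and w: "set w \<subseteq> X"
  shows "mon w \<in> P.span (mon ` {w. set w \<subseteq> X \<and> (\<forall>u\<in>S. \<not> sublist u w)} \<union> multiples X (g ` S))"
  using w
proof (induction w rule: wfp_induct_rule[OF wf_word_less])
  case (1 w)
  let ?B = "mon ` {w. set w \<subseteq> X \<and> (\<forall>u\<in>S. \<not> sublist u w)} \<union> multiples X (g ` S)"
  show ?case
  proof (cases "\<forall>u\<in>S. \<not> sublist u w")
    case True
    with 1(2) show ?thesis by (intro P.span_base) auto
  next
    case False
    then obtain a u b where u: "u \<in> S" and w: "w = a @ u @ b" by (auto simp: sublist_def)
    have "mon a * (g u - mon u) * mon b \<in> P.span ?B"
    proof (rule sandwich_span[OF in_span_mon[OF subset_refl]])
      fix x :: "nat list \<Rightarrow>\<^sub>0 'a" assume "x \<in> mon ` Poly_Mapping.keys (g u - mon u)"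
      then obtain v where v: "x = mon v" "v \<prec> u" "set v \<subseteq> X" using lead[OF u] by blast
      have "mon (a @ v @ b) \<in> P.span ?B"
        using 1 word_less_context[OF v(2), of a b] v(3) by (simp add: w)
      then show "mon a * x * mon b \<in> P.span ?B" by (simp add: v mon_mult)
    qed
    moreover have "mon a * g u * mon b \<in> multiples X (g ` S)"
      using 1(2) u by (intro multiples_base) (auto simp: w)
    then have "mon a * g u * mon b \<in> P.span ?B" by (intro P.span_base) simp
    ultimately have "mon a * g u * mon b - mon a * (g u - mon u) * mon b \<in> P.span ?B"
      by (rule P.span_diff[rotated])
    then show ?thesis by (simp add: w algebra_simps mon_mult)
  qed
qed


section \<open>Alternating sums over arrangements of letters\<close>

text \<open>
  For a word without repetitions this is \<open>(-1)\<close> to the number of inversions. The recursion, unlike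
  the sign of a permutation of positions, makes it easy to split off letters.
\<close>

primrec word_sign :: "nat list \<Rightarrow> int" where
  "word_sign [] = 1"
| "word_sign (x # v) = (- 1) ^ card {y \<in> set v. y < x} * word_sign v"

text \<open>
  A letter \<open>x\<close> at the end forms an inversion with each larger letter before it.
\<close>

lemma word_sign_snoc:
  "distinct (v @ [x]) \<Longrightarrow> word_sign (v @ [x]) = (- 1) ^ card {y \<in> set v. x < y} * word_sign v"
proof (induction v)
  case (Cons a v)
  show ?case
  proof (cases "x < a")
    case True
    then have "{y \<in> set (v @ [x]). y < a} = insert x {y \<in> set v. y < a}"
      "{y \<in> set (a # v). x < y} = insert a {y \<in> set v. x < y}" by auto
    with Cons True show ?thesis by simp
  next
    case False
    then have "{y \<in> set (v @ [x]). y < a} = {y \<in> set v. y < a}"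
      "{y \<in> set (a # v). x < y} = {y \<in> set v. x < y}" using Cons(2) by auto
    with Cons show ?thesis by simp
  qed
qed simp

lemma word_sign_swap:
  "distinct (u @ a # b # v) \<Longrightarrow> word_sign (u @ b # a # v) = - word_sign (u @ a # b # v)"
proof (induction u)
  case Nil
  have *: "word_sign (b # a # v) = - word_sign (a # b # v)"
    if "a < b" "a \<notin> set v" "b \<notin> set v" for a b
  proof -
    have "{y \<in> set (a # v). y < b} = insert a {y \<in> set v. y < b}"
      "{y \<in> set (b # v). y < a} = {y \<in> set v. y < a}" using that by auto
    with that show ?thesis by simp
  qed
  show ?case using *[of a b] *[of b a] Nil by (cases "a < b") auto
next
  case (Cons x u)
  have "set (u @ b # a # v) = set (u @ a # b # v)" by auto
  with Cons show ?case by simp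
qed

lemma descending_distinct: "sorted_wrt (>) (w :: nat list) \<Longrightarrow> distinct w"
  by (induction w) auto

lemma word_sign_descending:
  "sorted_wrt (>) w \<Longrightarrow> word_sign w = (- 1) ^ (length w div 2)"
proof (induction w)
  case (Cons x w)
  then have "{y \<in> set w. y < x} = set w" "distinct w"
    using descending_distinct[of w] by auto
  then have "card {y \<in> set w. y < x} = length w" by (simp add: distinct_card)
  with Cons show ?case by (cases "even (length w)") (auto elim!: oddE)
qed simp

text \<open>
  At the first place where an arrangement differs from the descending one it has a smaller letter,
  because the descending word puts the largest remaining letter there.
\<close>

lemma descending_word_max:
  "sorted_wrt (>) w \<Longrightarrow> mset v = mset w \<Longrightarrow> v \<noteq> w \<Longrightarrow> v \<prec> w"
proof (induction w arbitrary: v)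
  case (Cons x w)
  then obtain y v' where v: "v = y # v'" by (cases v) auto
  then have len: "length v' = length w" using Cons(3) by (metis length_Cons nat.inject size_mset)
  show ?case
  proof (cases "y = x")
    case True
    with Cons v have "v' \<prec> w" by simp
    with True v len show ?thesis by (simp add: word_less_def Cons_lenlex_iff)
  next
    case False
    have "y \<in> set (x # w)" using Cons(3) v by (metis list.set_intros(1) mset_eq_setD)
    with False Cons(2) have "y < x" by auto
    with v len show ?thesis by (simp add: word_less_def Cons_lenlex_iff)
  qed
qed simp

text \<open>
  By induction on the length. Deleting the first letter of the arrangement deletes \<open>0 \<mapsto> j\<close> from the
  permutation, which changes the sign by \<open>(-1)\<^sup>j\<close> as in a cofactor expansion; and \<open>j\<close> is the number
  of inversions that the first letter takes part in.
\<close>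

lemma word_sign_permute_list:
  "sorted_wrt (<) L \<Longrightarrow> \<sigma> permutes {..<length L} \<Longrightarrow> word_sign (permute_list \<sigma> L) = sign \<sigma>"
proof (induction "length L" arbitrary: L \<sigma>)
  case 0
  then show ?case by (simp add: permute_list_def)
next
  case (Suc n)
  define j p where "j = \<sigma> 0" and "p = permutation_delete \<sigma> 0"
  have \<sigma>: "\<sigma> permutes {0..<Suc n}" using Suc by (simp add: atLeast0LessThan)
  have j: "j < Suc n" using permutes_in_image[OF \<sigma>, of 0] by (simp add: j_def)
  have p: "p permutes {0..<n}" using permutation_delete_permutes[OF \<sigma>] by (simp add: p_def)
  have \<sigma>_eq: "\<sigma> = permutation_insert 0 j p"
    using permutation_insert_delete[OF \<sigma>, of 0] by (simp add: j_def p_def)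
  define L' where "L' = take j L @ drop (Suc j) L"
  have len: "length L' = n" using Suc(2) j by (simp add: L'_def)
  have sorted: "sorted_wrt (<) L'"
  proof -
    have "sorted_wrt (<) (take j L @ L ! j # drop (Suc j) L)"
      using Suc(2,3) j by (simp add: id_take_nth_drop[symmetric])
    then show ?thesis by (simp add: L'_def sorted_wrt_append)
  qed
  have nth_L': "L' ! k = L ! (if k < j then k else Suc k)" if "k < n" for k
    using that Suc(2) j by (auto simp: L'_def nth_append)
  have pl: "permute_list \<sigma> L = L ! j # permute_list p L'"
  proof (rule nth_equalityI)
    show "length (permute_list \<sigma> L) = length (L ! j # permute_list p L')"
      using len Suc(2) by simp
    fix i assume "i < length (permute_list \<sigma> L)"
    then have i: "i < Suc n" using Suc(2) by simp
    show "permute_list \<sigma> L ! i = (L ! j # permute_list p L') ! i"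
    proof (cases i)
      case 0
      then show ?thesis using i Suc by (simp add: permute_list_nth j_def)
    next
      case (Suc k)
      then have k: "k < n" using i by simp
      have "p k < n" using permutes_in_image[OF p, of k] k by simp
      moreover have "\<sigma> (Suc k) = (if p k < j then p k else Suc (p k))"
        by (simp add: \<sigma>_eq permutation_insert_expand)
      ultimately show ?thesis
        using Suc k \<open>Suc n = length L\<close> \<open>\<sigma> permutes {..<length L}\<close> p len
        by (simp add: permute_list_nth nth_L' atLeast0LessThan)
    qed
  qed
  have "set (permute_list p L') = set L'"
    using p len by (simp add: atLeast0LessThan)
  moreover have "{y \<in> set L'. y < L ! j} = set (take j L)"
  proof -
    have "sorted_wrt (<) (take j L @ L ! j # drop (Suc j) L)"
      using Suc(2,3) j by (simp add: id_take_nth_drop[symmetric])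
    then show ?thesis by (fastforce simp: L'_def sorted_wrt_append)
  qed
  moreover have "card (set (take j L)) = j"
    using Suc(2,3) j by (simp add: distinct_card strict_sorted_iff)
  ultimately have "word_sign (permute_list \<sigma> L) = (- 1) ^ j * sign p"
    using Suc(1)[OF len[symmetric] sorted, of p] p len by (simp add: pl atLeast0LessThan)
  also have "\<dots> = sign \<sigma>"
    using signof_permutation_insert[OF p, of 0 j, where ?'a = int] j by (simp add: \<sigma>_eq)
  finally show ?case .
qed

text \<open>
  The alternating sum of the letters in \<open>D\<close>, indexed by the arrangements of \<open>D\<close> instead of the
  permutations of positions.
\<close>

definition alt_sum :: "nat set \<Rightarrow> (nat list \<Rightarrow>\<^sub>0 'a::field)" where
  "alt_sum D = (\<Sum>v\<in>permutations_of_set D. of_int (word_sign v) * mon v)"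

lemma prod_list_mon: "prod_list (map (\<lambda>j. mon [j]) v) = mon v"
  by (induction v) (simp_all add: mon_Nil mon_mult)

lemma alt_eq_alt_sum:
  assumes "sorted_wrt (<) L"
  shows "alt (map (\<lambda>j. mon [j]) L) = (alt_sum (set L) :: nat list \<Rightarrow>\<^sub>0 'a::field)"
proof -
  have dL: "distinct L" using assms by (simp add: strict_sorted_iff)
  have "bij_betw (\<lambda>\<sigma>. permute_list \<sigma> L) {\<sigma>. \<sigma> permutes {..<length L}} (permutations_of_set (set L))"
  proof (rule bij_betw_imageI)
    show "inj_on (\<lambda>\<sigma>. permute_list \<sigma> L) {\<sigma>. \<sigma> permutes {..<length L}}"
    proof (rule inj_onI, clarify)
      fix \<sigma> \<tau> assume h: "\<sigma> permutes {..<length L}" "\<tau> permutes {..<length L}"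
        "permute_list \<sigma> L = permute_list \<tau> L"
      show "\<sigma> = \<tau>"
      proof
        fix i
        show "\<sigma> i = \<tau> i"
        proof (cases "i < length L")
          case True
          then have "L ! \<sigma> i = L ! \<tau> i" using h permute_list_nth by metis
          moreover have "\<sigma> i < length L" "\<tau> i < length L"
            using True permutes_in_image[OF h(1), of i] permutes_in_image[OF h(2), of i] by simp_all
          ultimately show ?thesis using dL nth_eq_iff_index_eq by blast
        next
          case False
          then show ?thesis using h(1,2) by (simp add: permutes_def)
        qed
      qed
    qed
    show "(\<lambda>\<sigma>. permute_list \<sigma> L) ` {\<sigma>. \<sigma> permutes {..<length L}} = permutations_of_set (set L)"
    proof (intro equalityI subsetI)
      fix v assume "v \<in> permutations_of_set (set L)"
      then have "mset v = mset L" using dL by (simp add: permutations_of_set_def set_eq_iff_mset_eq_distinct[symmetric])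
      then obtain \<sigma> where "\<sigma> permutes {..<length L}" "permute_list \<sigma> L = v"
        by (metis mset_eq_permutation)
      then show "v \<in> (\<lambda>\<sigma>. permute_list \<sigma> L) ` {\<sigma>. \<sigma> permutes {..<length L}}" by blast
    qed (auto simp: permutations_of_set_def dL)
  qed
  then have "(alt_sum (set L) :: nat list \<Rightarrow>\<^sub>0 'a) = (\<Sum>\<sigma> | \<sigma> permutes {..<length L}.
      of_int (word_sign (permute_list \<sigma> L)) * mon (permute_list \<sigma> L))"
    unfolding alt_sum_def by (rule sum.reindex_bij_betw[symmetric])
  also have "\<dots> = alt (map (\<lambda>j. mon [j]) L)"
    unfolding alt_def
    by (intro sum.cong) (simp_all add: word_sign_permute_list[OF assms] permute_list_map prod_list_mon)
  finally show ?thesis by simp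
qed

lemma alt_sum_expand_first:
  assumes "finite D" "D \<noteq> {}"
  shows "(alt_sum D :: nat list \<Rightarrow>\<^sub>0 'a::field) = (\<Sum>x\<in>D. (- 1) ^ card {y \<in> D. y < x} * (mon [x] * alt_sum (D - {x})))"
proof -
  have "(alt_sum D :: nat list \<Rightarrow>\<^sub>0 'a) = (\<Sum>x\<in>D. \<Sum>w\<in>(#) x ` permutations_of_set (D - {x}). of_int (word_sign w) * mon w)"
    unfolding alt_sum_def permutations_of_set_nonempty[OF assms(2)]
    by (rule sum.UNION_disjoint) (use assms in auto)
  also have "\<dots> = (\<Sum>x\<in>D. (- 1) ^ card {y \<in> D. y < x} * (mon [x] * alt_sum (D - {x})))"
  proof (rule sum.cong[OF refl])
    fix x assume "x \<in> D"
    have "(\<Sum>w\<in>(#) x ` permutations_of_set (D - {x}). of_int (word_sign w) * (mon w :: nat list \<Rightarrow>\<^sub>0 'a))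
       = (\<Sum>v\<in>permutations_of_set (D - {x}). of_int (word_sign (x # v)) * mon (x # v))"
      by (subst sum.reindex) auto
    also have "\<dots> = (\<Sum>v\<in>permutations_of_set (D - {x}).
        (- 1) ^ card {y \<in> D. y < x} * (mon [x] * (of_int (word_sign v) * mon v)))"
    proof (rule sum.cong[OF refl])
      fix v assume "v \<in> permutations_of_set (D - {x})"
      then have "{y \<in> set v. y < x} = {y \<in> D. y < x}" by (auto simp: permutations_of_set_def)
      then show "of_int (word_sign (x # v)) * (mon (x # v) :: nat list \<Rightarrow>\<^sub>0 'a)
         = (- 1) ^ card {y \<in> D. y < x} * (mon [x] * (of_int (word_sign v) * mon v))"
        using mon_mult[of "[x]" v, where ?'a = 'a, symmetric]
        by (simp add: mult.assoc mult_of_int_commute)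
    qed
    finally show "(\<Sum>w\<in>(#) x ` permutations_of_set (D - {x}). of_int (word_sign w) * mon w)
       = (- 1) ^ card {y \<in> D. y < x} * (mon [x] * (alt_sum (D - {x}) :: nat list \<Rightarrow>\<^sub>0 'a))"
      by (simp add: alt_sum_def sum_distrib_left)
  qed
  finally show ?thesis .
qed

lemma permutations_of_set_snoc:
  assumes "D \<noteq> {}"
  shows "permutations_of_set D = (\<Union>x\<in>D. (\<lambda>v. v @ [x]) ` permutations_of_set (D - {x}))"
proof (intro equalityI subsetI)
  fix w assume w: "w \<in> permutations_of_set D"
  with assms have "w \<noteq> []" by (auto simp: permutations_of_set_def)
  then obtain v x where "w = v @ [x]" by (metis rev_exhaust)
  with w have "x \<in> D" "v \<in> permutations_of_set (D - {x})" "w = v @ [x]"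
    by (auto simp: permutations_of_set_def)
  then show "w \<in> (\<Union>x\<in>D. (\<lambda>v. v @ [x]) ` permutations_of_set (D - {x}))" by blast
next
  fix w assume "w \<in> (\<Union>x\<in>D. (\<lambda>v. v @ [x]) ` permutations_of_set (D - {x}))"
  then obtain x v where "x \<in> D" "w = v @ [x]" "set v = D - {x}" "distinct v"
    unfolding permutations_of_set_def by blast
  then show "w \<in> permutations_of_set D"
    by (simp add: permutations_of_set_def insert_absorb)
qed

lemma alt_sum_expand_last:
  assumes "finite D" "D \<noteq> {}"
  shows "(alt_sum D :: nat list \<Rightarrow>\<^sub>0 'a::field) = (\<Sum>x\<in>D. (- 1) ^ card {y \<in> D. x < y} * (alt_sum (D - {x}) * mon [x]))"
proof -
  have "(alt_sum D :: nat list \<Rightarrow>\<^sub>0 'a) = (\<Sum>x\<in>D. \<Sum>w\<in>(\<lambda>v. v @ [x]) ` permutations_of_set (D - {x}). of_int (word_sign w) * mon w)"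
    unfolding alt_sum_def permutations_of_set_snoc[OF assms(2)]
    by (rule sum.UNION_disjoint) (use assms in auto)
  also have "\<dots> = (\<Sum>x\<in>D. (- 1) ^ card {y \<in> D. x < y} * (alt_sum (D - {x}) * mon [x]))"
  proof (rule sum.cong[OF refl])
    fix x assume "x \<in> D"
    have "(\<Sum>w\<in>(\<lambda>v. v @ [x]) ` permutations_of_set (D - {x}). of_int (word_sign w) * (mon w :: nat list \<Rightarrow>\<^sub>0 'a))
       = (\<Sum>v\<in>permutations_of_set (D - {x}). of_int (word_sign (v @ [x])) * mon (v @ [x]))"
      by (subst sum.reindex) (auto simp: inj_on_def)
    also have "\<dots> = (\<Sum>v\<in>permutations_of_set (D - {x}).
        (- 1) ^ card {y \<in> D. x < y} * (of_int (word_sign v) * mon v * mon [x]))"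
    proof (rule sum.cong[OF refl])
      fix v assume v: "v \<in> permutations_of_set (D - {x})"
      then have "{y \<in> set v. x < y} = {y \<in> D. x < y}" by (auto simp: permutations_of_set_def)
      moreover have "distinct (v @ [x])" using v by (auto simp: permutations_of_set_def)
      ultimately show "of_int (word_sign (v @ [x])) * (mon (v @ [x]) :: nat list \<Rightarrow>\<^sub>0 'a)
         = (- 1) ^ card {y \<in> D. x < y} * (of_int (word_sign v) * mon v * mon [x])"
        by (simp add: word_sign_snoc mult.assoc mon_mult)
    qed
    finally show "(\<Sum>w\<in>(\<lambda>v. v @ [x]) ` permutations_of_set (D - {x}). of_int (word_sign w) * mon w)
       = (- 1) ^ card {y \<in> D. x < y} * ((alt_sum (D - {x}) :: nat list \<Rightarrow>\<^sub>0 'a) * mon [x])"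
      by (simp add: alt_sum_def sum_distrib_left sum_distrib_right)
  qed
  finally show ?thesis .
qed

text \<open>
  Expand the alternating sum of all letters along the first and along the last letter. The letter
  \<open>i\<close> gets the sign \<open>(-1) ^ (i - 1)\<close> in the former and \<open>(-1) ^ (n + 1 - i)\<close> in the latter, and
  these agree for even \<open>n\<close>.
\<close>

lemma alt_sum_commutators:
  assumes "even n" and D: "D = {1..n+1}"
  shows "(\<Sum>i\<in>D. (- 1) ^ i * (mon [i] * alt_sum (D - {i}) - alt_sum (D - {i}) * mon [i]))
    = (0 :: nat list \<Rightarrow>\<^sub>0 'a::field)"
proof -
  let ?A = "\<lambda>i. alt_sum (D - {i}) :: nat list \<Rightarrow>\<^sub>0 'a"
  have fin: "finite D" "D \<noteq> {}" by (simp_all add: D)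
  have signs: "(- 1) ^ card {y \<in> D. y < i} = - ((- 1) ^ i :: nat list \<Rightarrow>\<^sub>0 'a)"
    "(- 1) ^ card {y \<in> D. i < y} = - ((- 1) ^ i :: nat list \<Rightarrow>\<^sub>0 'a)" if "i \<in> D" for i
  proof -
    have "{y \<in> D. y < i} = {1..<i}" "{y \<in> D. i < y} = {i<..n+1}" using that by (auto simp: D)
    then have c: "card {y \<in> D. y < i} = i - 1" "card {y \<in> D. i < y} = n + 1 - i" by simp_all
    show "(- 1) ^ card {y \<in> D. y < i} = - ((- 1) ^ i :: nat list \<Rightarrow>\<^sub>0 'a)"
      using that unfolding c by (cases i) (auto simp: D)
    have "even (n + 1 - i) \<longleftrightarrow> odd i" using assms that by auto
    then show "(- 1) ^ card {y \<in> D. i < y} = - ((- 1) ^ i :: nat list \<Rightarrow>\<^sub>0 'a)"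
      unfolding c by (cases "even i") auto
  qed
  have "(\<Sum>i\<in>D. - ((- 1) ^ i) * (mon [i] * ?A i)) = alt_sum D"
    unfolding alt_sum_expand_first[OF fin] by (intro sum.cong refl) (simp only: signs)
  moreover have "(\<Sum>i\<in>D. - ((- 1) ^ i) * (?A i * mon [i])) = alt_sum D"
    unfolding alt_sum_expand_last[OF fin] by (intro sum.cong refl) (simp only: signs)
  moreover have "(\<Sum>i\<in>D. (- 1) ^ i * (mon [i] * ?A i - ?A i * mon [i]))
      = (\<Sum>i\<in>D. - ((- 1) ^ i) * (?A i * mon [i])) - (\<Sum>i\<in>D. - ((- 1) ^ i) * (mon [i] * ?A i))"
    unfolding sum_subtractf[symmetric] by (intro sum.cong refl) (simp add: algebra_simps)
  ultimately show ?thesis by simp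
qed


section \<open>Ideals and quotients of the free algebra\<close>

lemma mon_eq_iff: "(mon u :: nat list \<Rightarrow>\<^sub>0 'a::field) = mon v \<longleftrightarrow> u = v"
proof
  assume "(mon u :: nat list \<Rightarrow>\<^sub>0 'a) = mon v"
  then have "Poly_Mapping.keys (mon u :: nat list \<Rightarrow>\<^sub>0 'a) = Poly_Mapping.keys (mon v :: nat list \<Rightarrow>\<^sub>0 'a)" by simp
  then show "u = v" by (simp add: mon_def)
qed simp

lemma carrier_free_alg: "carrier (free_alg m) = {p. \<forall>w\<in>Poly_Mapping.keys p. set w \<subseteq> {1..m}}"
  and free_alg_ops: "monoid.mult (free_alg m) = (*)" "one (free_alg m) = 1" "zero (free_alg m) = 0"
    "add (free_alg m) = (+)"
  by (simp_all add: free_alg_def)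

lemma carrier_free_alg_eq_span: "(carrier (free_alg m) :: (nat list \<Rightarrow>\<^sub>0 'a::field) set) = P.span (mon ` {w. set w \<subseteq> {1..m}})"
proof (intro Set.set_eqI iffI)
  fix p :: "nat list \<Rightarrow>\<^sub>0 'a"
  show "p \<in> P.span (mon ` {w. set w \<subseteq> {1..m}})" if "p \<in> carrier (free_alg m)"
    using that by (intro in_span_mon) (auto simp: carrier_free_alg)
  show "p \<in> carrier (free_alg m)" if "p \<in> P.span (mon ` {w. set w \<subseteq> {1..m}})"
    using keys_in_span_mon[OF that] by (auto simp: carrier_free_alg)
qed

lemma mon_in_free_alg: "set w \<subseteq> {1..m} \<Longrightarrow> mon w \<in> carrier (free_alg m)"
  unfolding carrier_free_alg_eq_span by (intro P.span_base) blast

lemma mult_in_free_alg: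
  assumes "p \<in> carrier (free_alg m)" "q \<in> carrier (free_alg m)"
  shows "p * q \<in> carrier (free_alg m)"
proof -
  have "set w \<subseteq> {1..m}" if "w \<in> Poly_Mapping.keys (p * q)" for w
  proof -
    have "w \<in> {u + v |u v. u \<in> Poly_Mapping.keys p \<and> v \<in> Poly_Mapping.keys q}"
      by (rule subsetD[OF keys_mult that])
    then obtain u v where "w = u @ v" "u \<in> Poly_Mapping.keys p" "v \<in> Poly_Mapping.keys q"
      by (auto simp: plus_list_def)
    with assms show ?thesis by (simp add: carrier_free_alg)
  qed
  then show ?thesis by (simp add: carrier_free_alg)
qed

lemma const_in_free_alg: "const c \<in> carrier (free_alg m)"
  by (auto simp: carrier_free_alg const_def)

lemma ring_free_alg: "ring (free_alg m :: (nat list \<Rightarrow>\<^sub>0 'a::field) ring)"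
proof (rule ringI)
  show "abelian_group (free_alg m :: (nat list \<Rightarrow>\<^sub>0 'a) ring)"
  proof (rule abelian_groupI)
    fix p :: "nat list \<Rightarrow>\<^sub>0 'a" assume "p \<in> carrier (free_alg m)"
    then show "\<exists>q\<in>carrier (free_alg m). q \<oplus>\<^bsub>free_alg m\<^esub> p = \<zero>\<^bsub>free_alg m\<^esub>"
      unfolding carrier_free_alg_eq_span free_alg_ops
      by (intro bexI[of _ "- p"]) (auto intro: P.span_neg)
  qed (auto simp: carrier_free_alg_eq_span free_alg_ops P.span_zero P.span_add ac_simps)
  show "Group.monoid (free_alg m :: (nat list \<Rightarrow>\<^sub>0 'a) ring)"
    by (rule monoidI)
      (auto simp: free_alg_ops mult_in_free_alg mult.assoc const_in_free_alg[of 1, unfolded const_hom])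
qed (auto simp: free_alg_ops distrib_right distrib_left)

lemma a_inv_free_alg:
  assumes "p \<in> carrier (free_alg m)"
  shows "\<ominus>\<^bsub>free_alg m\<^esub> p = - p"
proof -
  interpret ring "free_alg m :: (nat list \<Rightarrow>\<^sub>0 'a) ring" by (rule ring_free_alg)
  have "- p \<in> carrier (free_alg m)" using assms by (simp add: carrier_free_alg_eq_span P.span_neg)
  then show ?thesis using assms
    by (intro minus_equality) (simp_all add: free_alg_ops)
qed

lemma multiples_subspace: "P.subspace (multiples X G)"
  by (simp add: multiples_def)

lemma multiples_mon_mult:
  assumes "f \<in> multiples X G" "set a \<subseteq> X" "set b \<subseteq> X"
  shows "mon a * f * mon b \<in> multiples X G"
  using assms(1) unfolding multiples_def
proof (rule sandwich_span)
  fix x assume "x \<in> {mon a * f * mon b |a b f. set a \<subseteq> X \<and> set b \<subseteq> X \<and> f \<in> G}"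
  then obtain c d h where x: "x = mon c * h * mon d" "set c \<subseteq> X" "set d \<subseteq> X" "h \<in> G" by blast
  have "mon a * x * mon b = mon (a @ c) * h * mon (d @ b)"
    unfolding x(1) mon_mult[symmetric] by (simp only: mult.assoc)
  then show "mon a * x * mon b \<in> P.span {mon a * f * mon b |a b f. set a \<subseteq> X \<and> set b \<subseteq> X \<and> f \<in> G}"
    using multiples_base[OF x(4), of "a @ c" X "d @ b"] x assms by (simp add: multiples_def)
qed

lemma multiples_eqI:
  assumes "G \<subseteq> multiples X H" "H \<subseteq> multiples X G"
  shows "multiples X G = multiples X H"
proof -
  have "multiples X G \<subseteq> multiples X H" if "G \<subseteq> multiples X H" for G H
    unfolding multiples_def[of X G]
    by (rule P.span_minimal[OF _ multiples_subspace]) (use that multiples_mon_mult in blast)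
  with assms show ?thesis by blast
qed

lemma multiples_mult:
  assumes f: "f \<in> multiples {1..m} G" and p: "p \<in> carrier (free_alg m)"
  shows "p * f \<in> multiples {1..m} G" "f * p \<in> multiples {1..m} G"
proof -
  have p': "p \<in> P.span (mon ` {w. set w \<subseteq> {1..m}})" using p by (simp add: carrier_free_alg_eq_span)
  have "1 * p * f \<in> P.span (multiples {1..m} G)"
    by (rule sandwich_span[OF p'], rule P.span_base)
      (use multiples_mon_mult[OF f, of _ "[]"] in \<open>auto simp: mon_Nil\<close>)
  then show "p * f \<in> multiples {1..m} G" by (simp add: multiples_def P.span_span)
  have "f * p * 1 \<in> P.span (multiples {1..m} G)"
    by (rule sandwich_span[OF p'], rule P.span_base)
      (use multiples_mon_mult[OF f, of "[]"] in \<open>auto simp: mon_Nil\<close>)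
  then show "f * p \<in> multiples {1..m} G" by (simp add: multiples_def P.span_span)
qed

lemma ideal_subspace:
  assumes "ideal I (free_alg m)"
  shows "P.subspace I"
proof -
  interpret ideal I "free_alg m :: (nat list \<Rightarrow>\<^sub>0 'a) ring" by fact
  show ?thesis
    using additive_subgroup.zero_closed[OF is_additive_subgroup]
      additive_subgroup.a_closed[OF is_additive_subgroup] I_l_closed[OF _ const_in_free_alg]
    by (auto simp: P.subspace_def free_alg_ops scl_def)
qed

lemma ideal_multiples:
  assumes "G \<subseteq> carrier (free_alg m)"
  shows "ideal (multiples {1..m} G) (free_alg m)"
proof (rule idealI)
  let ?J = "multiples {1..m} G"
  have sub: "?J \<subseteq> carrier (free_alg m)"
    unfolding multiples_def carrier_free_alg_eq_span
  proof (rule P.span_minimal[OF _ P.subspace_span], clarify)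
    fix a b f assume "set a \<subseteq> {1..m}" "set b \<subseteq> {1..m}" "f \<in> G"
    with assms show "mon a * f * mon b \<in> P.span (mon ` {w. set w \<subseteq> {1..m}})"
      unfolding carrier_free_alg_eq_span[symmetric]
      by (intro mult_in_free_alg mon_in_free_alg) auto
  qed
  show "subgroup ?J (add_monoid (free_alg m))"
  proof
    fix p assume p: "p \<in> ?J"
    then have "- p \<in> ?J" by (simp add: multiples_def P.span_neg)
    moreover have "inv\<^bsub>add_monoid (free_alg m)\<^esub> p = - p"
      using a_inv_free_alg[of p m] p sub by (auto simp: a_inv_def)
    ultimately show "inv\<^bsub>add_monoid (free_alg m)\<^esub> p \<in> ?J" by simp
  qed (use sub in \<open>auto simp: free_alg_ops multiples_def P.span_add P.span_zero\<close>)
qed (use multiples_mult in \<open>auto simp: ring_free_alg free_alg_ops\<close>)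

lemma genideal_eq_multiples:
  assumes G: "G \<subseteq> carrier (free_alg m)"
  shows "genideal (free_alg m) G = multiples {1..m} G"
proof (rule antisym)
  have "G \<subseteq> multiples {1..m} G"
    using multiples_base[of _ G "[]" "{1..m}" "[]"] by (auto simp: mon_Nil)
  then show "genideal (free_alg m) G \<subseteq> multiples {1..m} G"
    unfolding genideal_def using ideal_multiples[OF G] by blast
next
  have "multiples {1..m} G \<subseteq> I" if I: "ideal I (free_alg m)" and "G \<subseteq> I" for I
    unfolding multiples_def
  proof (rule P.span_minimal[OF _ ideal_subspace[OF I]], clarify)
    fix a b f assume *: "set a \<subseteq> {1..m}" "set b \<subseteq> {1..m}" "f \<in> G"
    have "mon a * f \<in> I"
      using ideal.I_l_closed[OF I _ mon_in_free_alg[OF *(1)], of f] *(3) that(2)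
      by (auto simp: free_alg_ops)
    from ideal.I_r_closed[OF I this mon_in_free_alg[OF *(2)]]
    show "mon a * f * mon b \<in> I" by (simp add: free_alg_ops)
  qed
  then show "multiples {1..m} G \<subseteq> genideal (free_alg m) G"
    unfolding genideal_def by blast
qed

text \<open>
  The vector space underlying the envelope, for an arbitrary ideal.
\<close>

definition quotient_space :: "nat \<Rightarrow> (nat list \<Rightarrow>\<^sub>0 'a::field) set \<Rightarrow> ('a, (nat list \<Rightarrow>\<^sub>0 'a) set) module" where
  "quotient_space m I =
     (let R = free_alg m; Q = R Quot I in
      \<lparr>carrier = carrier Q, monoid.mult = monoid.mult Q, one = one Q, zero = zero Q, add = add Q,
       smult = (\<lambda>c A. (I +>\<^bsub>R\<^esub> const c) \<otimes>\<^bsub>Q\<^esub> A)\<rparr>)"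

lemma envelope_eq: "envelope scale n br e = quotient_space (n + 1) (env_ideal scale n br e)"
  by (simp add: envelope_def quotient_space_def Let_def)

locale free_alg_ideal =
  fixes m :: nat and I :: "(nat list \<Rightarrow>\<^sub>0 'a::field) set"
  assumes ideal: "ideal I (free_alg m)"
begin

abbreviation "R \<equiv> free_alg m :: (nat list \<Rightarrow>\<^sub>0 'a) ring"
abbreviation "V \<equiv> quotient_space m I"

definition coset :: "(nat list \<Rightarrow>\<^sub>0 'a) \<Rightarrow> (nat list \<Rightarrow>\<^sub>0 'a) set" where
  "coset p = I +>\<^bsub>R\<^esub> p"

sublocale I: ideal I R by (rule ideal)

lemma carrier_V: "carrier V = coset ` carrier R"
  by (auto simp: quotient_space_def Let_def FactRing_def A_RCOSETS_def' coset_def)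

lemma coset_eq_iff:
  assumes "p \<in> carrier R" "q \<in> carrier R"
  shows "coset p = coset q \<longleftrightarrow> p - q \<in> I"
proof -
  have "coset p = coset q \<longleftrightarrow> p \<ominus>\<^bsub>R\<^esub> q \<in> I"
    unfolding coset_def using I.quotient_eq_iff_same_a_r_cos[OF ideal assms] by blast
  also have "p \<ominus>\<^bsub>R\<^esub> q = p - q" using assms by (simp add: a_minus_def a_inv_free_alg free_alg_ops)
  finally show ?thesis .
qed

lemma coset_add:
  "p \<in> carrier R \<Longrightarrow> q \<in> carrier R \<Longrightarrow> coset p \<oplus>\<^bsub>V\<^esub> coset q = coset (p + q)"
  using I.a_rcos_sum[of p q]
  by (simp add: quotient_space_def Let_def FactRing_def coset_def free_alg_ops)

lemma coset_smult: "p \<in> carrier R \<Longrightarrow> c \<odot>\<^bsub>V\<^esub> coset p = coset (scl c p)"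
  using I.rcoset_mult_add[OF const_in_free_alg, of p c]
  by (simp add: quotient_space_def Let_def FactRing_def coset_def free_alg_ops scl_def)

lemma zero_V: "\<zero>\<^bsub>V\<^esub> = coset 0"
  using I.a_coset_add_zero[OF I.a_subset]
  by (simp add: quotient_space_def Let_def FactRing_def coset_def free_alg_ops)

lemma closed_R: "p \<in> carrier R \<Longrightarrow> q \<in> carrier R \<Longrightarrow> p + q \<in> carrier R"
  "p \<in> carrier R \<Longrightarrow> scl c p \<in> carrier R" "0 \<in> carrier R" "p \<in> carrier R \<Longrightarrow> - p \<in> carrier R"
  unfolding carrier_free_alg_eq_span by (simp_all add: P.span_add P.span_scale P.span_zero P.span_neg)

lemma abelian_group_V: "abelian_group V"
proof (rule abelian_groupI)
  fix x assume "x \<in> carrier V"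
  then obtain p where p: "p \<in> carrier R" "x = coset p" by (auto simp: carrier_V)
  then show "\<exists>y\<in>carrier V. y \<oplus>\<^bsub>V\<^esub> x = \<zero>\<^bsub>V\<^esub>"
    by (intro bexI[of _ "coset (- p)"]) (auto simp: carrier_V coset_add zero_V closed_R)
qed (auto simp: carrier_V coset_add closed_R zero_V ac_simps)

lemma vectorspace_V: "vectorspace class_ring V"
proof -
  have "Module.module class_ring V"
  proof (rule Module.moduleI)
    show "cring (class_ring :: 'a ring)" using class_field field.axioms(1) by (metis domain_def field_def)
    show "abelian_group V" by (rule abelian_group_V)
  qed (auto simp: carrier_V coset_add coset_smult closed_R
        P.scale_left_distrib P.scale_right_distrib)
  with class_field show ?thesis by (simp add: vectorspace_def)
qed

lemma finsum_coset:
  assumes "finite A" "\<And>w. w \<in> A \<Longrightarrow> p w \<in> carrier R"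
  shows "finsum V (\<lambda>w. coset (p w)) A = coset (\<Sum>w\<in>A. p w) \<and> (\<Sum>w\<in>A. p w) \<in> carrier R"
  using assms
proof (induction A rule: finite_induct)
  interpret V: abelian_group V by (rule abelian_group_V)
  case empty
  then show ?case by (simp add: zero_V closed_R)
next
  interpret V: abelian_group V by (rule abelian_group_V)
  case (insert a A)
  then show ?case
    by (subst V.finsum_insert) (auto simp: carrier_V coset_add closed_R)
qed

lemma lincomb_monomials:
  assumes W: "W \<subseteq> {w. set w \<subseteq> {1..m}}" "finite W" "inj_on (\<lambda>w. coset (mon w)) W"
  shows "LinearCombinations.module.lincomb V a ((\<lambda>w. coset (mon w)) ` W)
    = coset (\<Sum>w\<in>W. scl (a (coset (mon w))) (mon w))"
proof -
  interpret vectorspace class_ring V by (rule vectorspace_V)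
  have mon: "mon w \<in> carrier R" if "w \<in> W" for w using that W(1) by (intro mon_in_free_alg) auto
  have "lincomb a ((\<lambda>w. coset (mon w)) ` W)
      = finsum V (\<lambda>w. a (coset (mon w)) \<odot>\<^bsub>V\<^esub> coset (mon w)) W"
    unfolding lincomb_def
    by (subst M.finsum_reindex) (use mon W(3) in \<open>auto simp: carrier_V coset_smult closed_R\<close>)
  also have "\<dots> = finsum V (\<lambda>w. coset (scl (a (coset (mon w))) (mon w))) W"
    by (intro M.finsum_cong') (use mon in \<open>auto simp: carrier_V coset_smult closed_R\<close>)
  also have "\<dots> = coset (\<Sum>w\<in>W. scl (a (coset (mon w))) (mon w))"
    using finsum_coset[OF W(2)] mon by (simp add: closed_R)
  finally show ?thesis .
qed

text \<open>
  A linear relation between the cosets of words in \<open>W\<close> is an element of \<open>I\<close> in which only words from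
  \<open>W\<close> occur, and a polynomial congruent to one over \<open>W\<close> has its coset in the span of the cosets.
\<close>

lemma monomials_basis:
  assumes W: "W \<subseteq> {w. set w \<subseteq> {1..m}}"
    and ind: "\<And>f. f \<in> I \<Longrightarrow> Poly_Mapping.keys f \<subseteq> W \<Longrightarrow> f = 0"
    and gen: "\<And>w. set w \<subseteq> {1..m} \<Longrightarrow> mon w \<in> P.span (mon ` W \<union> I)"
  shows "inj_on (\<lambda>w. coset (mon w)) W"
    and "vectorspace.basis class_ring V ((\<lambda>w. coset (mon w)) ` W)"
proof -
  have mon: "mon w \<in> carrier R" if "w \<in> W" for w using that W(1) by (intro mon_in_free_alg) auto
  show inj: "inj_on (\<lambda>w. coset (mon w)) W"
  proof (rule inj_onI)
    fix u v assume uv: "u \<in> W" "v \<in> W" "coset (mon u) = coset (mon v)"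
    have "mon u - mon v \<in> P.span (mon ` W)" using uv by (intro P.span_diff P.span_base) auto
    moreover have "mon u - mon v \<in> I" using uv by (simp add: coset_eq_iff mon)
    ultimately have "mon u - (mon v :: nat list \<Rightarrow>\<^sub>0 'a) = 0"
      by (intro ind keys_in_span_mon)
    then show "u = v" by (simp add: mon_eq_iff)
  qed
  interpret vectorspace class_ring V by (rule vectorspace_V)
  have "\<not> lin_dep ((\<lambda>w. coset (mon w)) ` W)"
  proof
    assume "lin_dep ((\<lambda>w. coset (mon w)) ` W)"
    then obtain B a v where B: "finite B" "B \<subseteq> (\<lambda>w. coset (mon w)) ` W"
      "lincomb a B = \<zero>\<^bsub>V\<^esub>" "v \<in> B" "a v \<noteq> 0"
      by (auto simp: lin_dep_def)
    then obtain A where A: "A \<subseteq> W" "finite A" "B = (\<lambda>w. coset (mon w)) ` A"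
      by (meson finite_subset_image)
    define f where "f = (\<Sum>w\<in>A. scl (a (coset (mon w))) (mon w :: nat list \<Rightarrow>\<^sub>0 'a))"
    have f_span: "f \<in> P.span (mon ` A)"
      unfolding f_def by (intro P.span_sum P.span_scale P.span_base) auto
    have "f \<in> carrier R"
      unfolding f_def using finsum_coset[OF A(2), of "\<lambda>w. scl (a (coset (mon w))) (mon w)"] A(1)
      by (auto intro!: closed_R(2) mon)
    moreover have "coset f = coset 0"
      using lincomb_monomials[OF _ A(2), of a] A(1,3) B(3) W inj_on_subset[OF inj A(1)]
      by (auto simp: f_def zero_V)
    ultimately have "f \<in> I" by (simp add: coset_eq_iff closed_R)
    then have "f = 0" using ind keys_in_span_mon[OF f_span] A(1) by blast
    obtain u where u: "u \<in> A" "v = coset (mon u)" using B(4) A(3) by blast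
    have "Poly_Mapping.lookup f u = (\<Sum>w\<in>A. if u = w then a (coset (mon w)) else 0)"
      unfolding f_def lookup_sum
      by (intro sum.cong refl) (auto simp: lookup_scl mon_def lookup_single when_def)
    also have "\<dots> = a v" using u A(2) by simp
    finally show False using \<open>f = 0\<close> B(5) by simp
  qed
  moreover have carrier: "(\<lambda>w. coset (mon w)) ` W \<subseteq> carrier V" using mon by (auto simp: carrier_V)
  moreover have "span ((\<lambda>w. coset (mon w)) ` W) = carrier V"
  proof (rule antisym)
    show "span ((\<lambda>w. coset (mon w)) ` W) \<subseteq> carrier V" using carrier by (rule span_is_subset2)
    show "carrier V \<subseteq> span ((\<lambda>w. coset (mon w)) ` W)"
    proof
      fix x assume "x \<in> carrier V"
      then obtain p where p: "p \<in> carrier R" "x = coset p" by (auto simp: carrier_V)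
      have "p \<in> P.span (mon ` {w. set w \<subseteq> {1..m}})" using p by (simp add: carrier_free_alg_eq_span)
      also have "\<dots> \<subseteq> P.span (mon ` W \<union> I)"
        by (rule P.span_minimal[OF _ P.subspace_span]) (use gen in auto)
      finally obtain h i where hi: "p = h + i" "h \<in> P.span (mon ` W)" "i \<in> I"
        unfolding P.span_Un P.span_eq_iff[THEN iffD2, OF ideal_subspace[OF ideal]] by blast
      have keys: "Poly_Mapping.keys h \<subseteq> W" using keys_in_span_mon[OF hi(2)] .
      have h: "h \<in> carrier R" using keys W by (auto simp: carrier_free_alg)
      have "x = coset h" using p hi h by (simp add: coset_eq_iff)
      \<comment> \<open>The coefficients must be a function of the coset, from which the word is recovered.\<close>
      define a where "a = (\<lambda>x. Poly_Mapping.lookup h (the_inv_into W (\<lambda>w. coset (mon w)) x))"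
      have "a (coset (mon w)) = Poly_Mapping.lookup h w" if "w \<in> Poly_Mapping.keys h" for w
        using that keys by (simp add: a_def the_inv_into_f_f[OF inj subsetD])
      then have "(\<Sum>w\<in>Poly_Mapping.keys h. scl (a (coset (mon w))) (mon w))
          = (\<Sum>w\<in>Poly_Mapping.keys h. const (Poly_Mapping.lookup h w) * mon w)"
        by (intro sum.cong refl) (simp add: scl_def)
      also have "\<dots> = h" by (rule poly_expand[symmetric])
      finally have "(\<Sum>w\<in>Poly_Mapping.keys h. scl (a (coset (mon w))) (mon w)) = h" .
      then have "x = lincomb a ((\<lambda>w. coset (mon w)) ` Poly_Mapping.keys h)"
        using lincomb_monomials[OF subset_trans[OF keys W] finite_keys inj_on_subset[OF inj keys], of a]
        by (simp only: \<open>x = coset h\<close>)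
      moreover have "finite ((\<lambda>w. coset (mon w)) ` Poly_Mapping.keys h)" by simp
      moreover have "(\<lambda>w. coset (mon w)) ` Poly_Mapping.keys h \<subseteq> (\<lambda>w. coset (mon w)) ` W"
        using keys by (rule image_mono)
      moreover have "a \<in> (\<lambda>w. coset (mon w)) ` Poly_Mapping.keys h \<rightarrow> carrier class_ring" by simp
      ultimately show "x \<in> span ((\<lambda>w. coset (mon w)) ` W)"
        unfolding span_def by blast
    qed
  qed
  ultimately show "basis ((\<lambda>w. coset (mon w)) ` W)" by (simp add: basis_def)
qed

end


section \<open>The defining relations and their composition\<close>

lemma of_int_mult_scl: "of_int k * p = scl (of_int k) p"
  by (simp add: scl_def const_def flip: zero_list_def)

lemma minus_one_power_mult_scl: "(- 1) ^ k * p = scl ((- 1) ^ k) p"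
  by (cases "even k") (simp_all add: P.scale_minus_left)

lemma strict_sorted_omit: "sorted_wrt (<) (omit n i)"
  unfolding omit_def by (intro sorted_wrt_filter sorted_wrt_upt)

lemma set_omit: "set (omit n i) = {1..n+1} - {i}"
  by (auto simp: omit_def)

lemma distinct_omit: "distinct (omit n i)"
  by (simp add: omit_def)

lemma length_omit: "i \<in> {1..n+1} \<Longrightarrow> length (omit n i) = n"
  using distinct_card[OF distinct_omit[of n i]] by (simp add: set_omit)

lemma descending_eqI:
  assumes "sorted_wrt (>) v" "sorted_wrt (>) w" "set v = set (w :: nat list)"
  shows "v = w"
  using strict_sorted_equal[of "rev v" "rev w"] assms by (simp add: sorted_wrt_rev)

lemma perm_less_descending:
  assumes "sorted_wrt (>) w" "v \<in> permutations_of_set (set w)" "v \<noteq> w"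
  shows "v \<prec> w"
proof (rule descending_word_max)
  show "mset v = mset w"
    using assms(1,2) descending_distinct[of w]
    by (subst set_eq_iff_mset_eq_distinct[symmetric]) (simp_all add: permutations_of_set_def)
qed (use assms in simp_all)

lemma descending_eq: "descending n = (\<lambda>i. rev (omit n i)) ` {1..n+1}"
proof (intro equalityI subsetI)
  fix w assume "w \<in> descending n"
  then have w: "length w = n" "set w \<subseteq> {1..n+1}" "sorted_wrt (>) w" by (auto simp: descending_def)
  then have "card ({1..n+1} - set w) = 1"
    using descending_distinct[OF w(3)] by (simp add: card_Diff_subset distinct_card)
  then obtain i where i: "{1..n+1} - set w = {i}" by (auto simp: card_1_singleton_iff)
  then have "set w = set (rev (omit n i))" using w(2) by (auto simp: set_omit)
  then have "w = rev (omit n i)"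
    using w(3) strict_sorted_omit by (intro descending_eqI) (simp_all add: sorted_wrt_rev)
  then show "w \<in> (\<lambda>i. rev (omit n i)) ` {1..n+1}" using i by blast
next
  fix w assume "w \<in> (\<lambda>i. rev (omit n i)) ` {1..n+1}"
  then show "w \<in> descending n"
    using strict_sorted_omit length_omit set_omit by (auto simp: descending_def sorted_wrt_rev)
qed

lemma permutations_of_set_extend:
  assumes "w \<in> permutations_of_set (A - {x})" "x \<in> A"
  shows "x # w \<in> permutations_of_set A" "w @ [x] \<in> permutations_of_set A"
proof -
  have w: "set w = A - {x}" "distinct w" using assms(1) unfolding permutations_of_set_def by blast+
  then have "set (x # w) = A" "set (w @ [x]) = A" using assms(2) by (simp_all add: w insert_absorb)
  with w show "x # w \<in> permutations_of_set A" "w @ [x] \<in> permutations_of_set A"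
    by (simp_all only: permutations_of_set_def mem_Collect_eq distinct.simps distinct_append) auto
qed

text \<open>
  \<open>Y i\<close> is the image in the free algebra of the bracket without \<open>e\<^sub>i\<close>. All that matters about it
  for the leading words is that it is a combination of letters.
\<close>

locale even_envelope =
  fixes n :: nat and Y :: "nat \<Rightarrow> (nat list \<Rightarrow>\<^sub>0 'a::field)"
  assumes n: "even n" "n \<ge> 4"
    and Y: "\<And>i. i \<in> {1..n+1} \<Longrightarrow> Y i \<in> P.span (mon ` {[j] |j. j \<in> {1..n+1}})"
begin

abbreviation "D \<equiv> {1..n+1}"

definition \<sigma> :: 'a where "\<sigma> = (- 1) ^ (n div 2)"

text \<open>
  The generators of the ideal, with the constants from the definition in scalar form.
\<close>

definition G :: "nat \<Rightarrow> (nat list \<Rightarrow>\<^sub>0 'a)" where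
  "G i = scl \<sigma> (alt_sum (D - {i}) - Y i)"

text \<open>
  The obstruction to resolving the only composition of the generators.
\<close>

definition commutators :: "nat list \<Rightarrow>\<^sub>0 'a" where
  "commutators = (\<Sum>i\<in>D. scl ((- 1) ^ i) (mon [i] * Y i - Y i * mon [i]))"

definition full_word :: "nat list" where "full_word = rev [1..<n+2]"

lemma \<sigma>_square: "\<sigma> * \<sigma> = 1"
  by (simp add: \<sigma>_def flip: power_mult_distrib)

lemma set_full_word: "set full_word = D"
  by (auto simp: full_word_def simp del: upt_Suc)

lemma sorted_full_word: "sorted_wrt (>) full_word"
  by (simp add: full_word_def sorted_wrt_rev del: upt_Suc)

lemma perm_less_full:
  assumes "w \<in> permutations_of_set D" "w \<noteq> full_word"
  shows "w \<prec> full_word"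
  using assms unfolding set_full_word[symmetric]
  by (rule perm_less_descending[OF sorted_full_word])

lemma full_word_eq: "full_word = (n + 1) # rev [1..<n+1]" "full_word = rev [2..<n+2] @ [1]"
proof -
  have "[1..<n+2] = [1..<n+1] @ [n+1]" by simp
  then show "full_word = (n + 1) # rev [1..<n+1]" by (simp add: full_word_def del: upt_Suc)
  have "[1..<n+2] = 1 # [2..<n+2]" by (simp add: upt_conv_Cons numeral_2_eq_2 del: upt_Suc)
  then show "full_word = rev [2..<n+2] @ [1]" by (simp add: full_word_def del: upt_Suc)
qed

lemma word_less_full:
  assumes "w \<in> permutations_of_set (D - {i})" "i \<in> D"
  shows "i \<le> n \<Longrightarrow> i # w \<prec> full_word" "2 \<le> i \<Longrightarrow> w @ [i] \<prec> full_word"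
proof -
  note perms = permutations_of_set_extend[OF assms]
  show "i # w \<prec> full_word" if "i \<le> n"
    using that by (intro perm_less_full perms) (simp add: full_word_eq(1) del: upt_Suc)
  show "w @ [i] \<prec> full_word" if "2 \<le> i"
    using that by (intro perm_less_full perms) (simp add: full_word_eq(2) del: upt_Suc)
qed

lemma desc_in_perms: "rev (omit n i) \<in> permutations_of_set (D - {i})"
  using set_omit[of n i] distinct_omit by (simp add: permutations_of_set_def)

lemma perm_less_desc:
  assumes "v \<in> permutations_of_set (D - {i})" "v \<noteq> rev (omit n i)"
  shows "v \<prec> rev (omit n i)"
  by (rule perm_less_descending)
    (use assms strict_sorted_omit in \<open>simp_all add: set_omit sorted_wrt_rev del: upt_Suc\<close>)

lemma word_sign_desc: "i \<in> D \<Longrightarrow> of_int (word_sign (rev (omit n i))) = \<sigma>"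
  using word_sign_descending[of "rev (omit n i)"] strict_sorted_omit length_omit[of i n]
  by (simp add: sorted_wrt_rev \<sigma>_def)

lemma G_expand:
  "G i = (\<Sum>v\<in>permutations_of_set (D - {i}). scl (\<sigma> * of_int (word_sign v)) (mon v)) - scl \<sigma> (Y i)"
  by (simp add: G_def alt_sum_def of_int_mult_scl P.scale_right_diff_distrib P.scale_sum_right)

text \<open>
  The descending word is the largest arrangement, its sign \<open>word_sign_desc\<close> cancels against the
  factor \<open>\<sigma>\<close>, and \<open>Y i\<close> consists of words of length 1, shorter than \<open>n\<close>.
\<close>

lemma leading_G:
  assumes i: "i \<in> D" and v: "v \<in> Poly_Mapping.keys (G i - mon (rev (omit n i)))"
  shows "v \<prec> rev (omit n i) \<and> set v \<subseteq> D"
proof -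
  let ?w = "rev (omit n i)" and ?P = "permutations_of_set (D - {i})"
  let ?L = "{v. v \<prec> ?w \<and> set v \<subseteq> D}"
  have "(\<Sum>v\<in>?P. scl (\<sigma> * of_int (word_sign v)) (mon v))
      = mon ?w + (\<Sum>v\<in>?P - {?w}. scl (\<sigma> * of_int (word_sign v)) (mon v))"
    using desc_in_perms[of i] by (subst sum.remove[of _ ?w]) (simp_all add: word_sign_desc[OF i] \<sigma>_square)
  then have "G i - mon ?w = (\<Sum>v\<in>?P - {?w}. scl (\<sigma> * of_int (word_sign v)) (mon v)) - scl \<sigma> (Y i)"
    by (simp add: G_expand)
  also have "\<dots> \<in> P.span (mon ` ?L)"
  proof (intro P.span_diff P.span_sum P.span_scale)
    fix v assume "v \<in> ?P - {?w}"
    then show "mon v \<in> P.span (mon ` ?L)"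
      using perm_less_desc[of v i] by (intro P.span_base) (auto simp: permutations_of_set_def)
  next
    have "[j] \<prec> ?w" for j using length_omit[OF i] n by (simp add: word_less_def lenlex_conv)
    then have "P.span (mon ` {[j] |j. j \<in> D}) \<subseteq> P.span (mon ` ?L)" by (intro P.span_mono) auto
    then show "Y i \<in> P.span (mon ` ?L)" using Y[OF i] by blast
  qed
  finally show ?thesis using keys_in_span_mon v by blast
qed

lemma commutator_identity:
  "(\<Sum>i\<in>D. scl ((- 1) ^ i) (mon [i] * G i - G i * mon [i])) = - scl \<sigma> commutators"
proof -
  let ?A = "\<lambda>i. alt_sum (D - {i}) :: nat list \<Rightarrow>\<^sub>0 'a"
  have "(\<Sum>i\<in>D. scl ((- 1) ^ i) (mon [i] * ?A i - ?A i * mon [i])) = 0"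
    using alt_sum_commutators[OF n(1) refl, where ?'a = 'a] unfolding minus_one_power_mult_scl .
  moreover have "(\<Sum>i\<in>D. scl ((- 1) ^ i) (mon [i] * G i - G i * mon [i]))
    = scl \<sigma> ((\<Sum>i\<in>D. scl ((- 1) ^ i) (mon [i] * ?A i - ?A i * mon [i])) - commutators)"
    unfolding commutators_def sum_subtractf[symmetric] P.scale_sum_right
    by (intro sum.cong refl)
      (simp add: G_def mult_scl right_diff_distrib left_diff_distrib P.scale_right_diff_distrib mult.commute)
  ultimately show ?thesis by simp
qed

text \<open>
  Solve \<open>commutator_identity\<close> for the two products with leading word \<open>full_word\<close>, namely \<open>G\<^sub>1 x\<^sub>1\<close>
  and \<open>x\<^sub>n\<^sub>+\<^sub>1 G\<^sub>n\<^sub>+\<^sub>1\<close>. In the applications \<open>L\<close> is the space of multiples with leading word below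
  \<open>full_word\<close>.
\<close>

lemma composition_in_subspace:
  assumes L: "P.subspace L"
    and first: "\<And>i. i \<in> D \<Longrightarrow> i \<le> n \<Longrightarrow> mon [i] * G i \<in> L"
    and last: "\<And>i. i \<in> D \<Longrightarrow> 2 \<le> i \<Longrightarrow> G i * mon [i] \<in> L"
    and "commutators \<in> L"
  shows "G 1 * mon [1] - mon [n+1] * G (n+1) \<in> L"
proof -
  let ?c = "\<lambda>i. scl ((- 1) ^ i) (mon [i] * G i - G i * mon [i])"
  \<comment> \<open>As \<open>n\<close> is even, the summands for 1 and \<open>n + 1\<close> both have the sign \<open>-1\<close>.\<close>
  have "D = insert 1 (insert (n + 1) {2..n})" using n by auto
  then have "(\<Sum>i\<in>D. ?c i) = ?c 1 + (?c (n + 1) + (\<Sum>i\<in>{2..n}. ?c i))"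
    using n by simp
  also have "\<dots> = G 1 * mon [1] - mon [1] * G 1 + (G (n + 1) * mon [n+1] - mon [n+1] * G (n + 1)
      + (\<Sum>i\<in>{2..n}. ?c i))"
    using n(1) by (simp add: P.scale_minus_left)
  finally have "G 1 * mon [1] - mon [n+1] * G (n+1)
    = - scl \<sigma> commutators + mon [1] * G 1 - G (n+1) * mon [n+1] - (\<Sum>i\<in>{2..n}. ?c i)"
    unfolding commutator_identity by (simp add: algebra_simps)
  also have "\<dots> \<in> L"
    using n by (intro P.subspace_diff[OF L] P.subspace_add[OF L] P.subspace_neg[OF L]
        P.subspace_scale[OF L] P.subspace_sum[OF L] assms) auto
  finally show ?thesis .
qed

text \<open>
  This is why a nonzero obstruction is a new relation of the envelope.
\<close>

lemma commutators_multiple: "commutators \<in> multiples D (G ` D)"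
proof -
  have "mon [i] * G i - G i * mon [i] \<in> multiples D (G ` D)" if "i \<in> D" for i
    using multiples_base[of "G i" "G ` D" "[i]" D "[]"] multiples_base[of "G i" "G ` D" "[]" D "[i]"] that
    by (intro P.subspace_diff[OF multiples_subspace]) (auto simp: mon_Nil)
  then have "- scl \<sigma> commutators \<in> multiples D (G ` D)"
    unfolding commutator_identity[symmetric]
    by (intro P.subspace_sum[OF multiples_subspace] P.subspace_scale[OF multiples_subspace])
  then have "scl (- \<sigma>) (- scl \<sigma> commutators) \<in> multiples D (G ` D)"
    by (rule P.subspace_scale[OF multiples_subspace])
  then show ?thesis by (simp add: \<sigma>_square)
qed

end


section \<open>Descending leading words\<close>

lemma sublist_same_length: "sublist v u \<Longrightarrow> length v = length u \<Longrightarrow> v = u"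
  by (auto simp: sublist_def)

context even_envelope
begin

text \<open>
  A word of length \<open>n\<close> with distinct letters determines the relation it leads by the one letter it
  does not contain.
\<close>

definition missing :: "nat list \<Rightarrow> nat" where "missing w = the_elem (D - set w)"

lemma missing_eq: "i \<in> D \<Longrightarrow> set w = D - {i} \<Longrightarrow> missing w = i"
proof -
  assume "i \<in> D" "set w = D - {i}"
  then have "D - set w = {i}" by blast
  then show ?thesis by (simp only: missing_def the_elem_eq)
qed

definition gen_desc :: "nat list \<Rightarrow> (nat list \<Rightarrow>\<^sub>0 'a)" where
  "gen_desc w = (if w = [n+1, 1] then mon [n+1, 1] - mon [1, n+1] else G (missing w))"

lemma gen_desc_eq_G:
  assumes "i \<in> D" "set w = D - {i}" "length w = n"
  shows "gen_desc w = G i"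
proof -
  have "w \<noteq> [n+1, 1]"
  proof
    assume "w = [n+1, 1]"
    then have "length w = 2" by simp
    with assms(3) n show False by simp
  qed
  then show ?thesis unfolding gen_desc_def missing_eq[OF assms(1,2)] by (rule if_not_P)
qed

lemma gen_desc_omit: "i \<in> D \<Longrightarrow> gen_desc (rev (omit n i)) = G i"
  by (rule gen_desc_eq_G) (simp_all only: set_rev set_omit length_rev length_omit)

lemma descending_leading:
  assumes "u \<in> descending n \<union> E" "E \<subseteq> {[n+1, 1]}" "v \<in> Poly_Mapping.keys (gen_desc u - mon u)"
  shows "v \<prec> u \<and> set v \<subseteq> D"
  using assms(1)
proof
  assume "u \<in> descending n"
  then obtain i where "i \<in> D" "u = rev (omit n i)" by (auto simp: descending_eq)
  then show ?thesis using assms(3) leading_G gen_desc_omit by auto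
next
  assume "u \<in> E"
  then have u: "u = [n+1, 1]" using assms(2) by blast
  then have "gen_desc u - mon u = - mon [1, n+1]" by (simp add: gen_desc_def)
  then have "v = [1, n+1]" using assms(3) by (simp add: mon_def split: if_splits)
  then show ?thesis using u n by (simp add: word_less_def Cons_lenlex_iff)
qed

text \<open>
  Let \<open>p y\<close> and \<open>y z\<close> be descending words of length \<open>n\<close> with \<open>y\<close> nonempty. Then \<open>p y z\<close> is
  descending, and having more than \<open>n\<close> letters it is the full word; so \<open>p = x\<^sub>n\<^sub>+\<^sub>1\<close>, \<open>z = x\<^sub>1\<close>,
  and the composition is the one resolved by \<open>composition_in_subspace\<close>. The word \<open>x\<^sub>n\<^sub>+\<^sub>1 x\<^sub>1\<close>
  consists of the largest and the smallest letter; a descending word can end with the largest or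
  begin with the smallest letter only if it has length 1, and contains both of them side by side
  only if it has length 2.
\<close>

lemma descending_system:
  assumes E: "E = {} \<and> commutators = 0 \<or>
      E = {[n+1, 1]} \<and> commutators = - (mon [n+1, 1] - mon [1, n+1])"
  shows "confluent_word_system (descending n \<union> E) gen_desc"
proof
  let ?S = "descending n \<union> E"
  have E': "w = [n+1, 1]" if "w \<in> E" for w using E that by blast
  have desc: "length w = n" "set w \<subseteq> D" "sorted_wrt (>) w" if "w \<in> descending n" for w
    using that by (auto simp: descending_def)
  show "v \<prec> u" if "u \<in> ?S" "v \<in> Poly_Mapping.keys (gen_desc u - mon u)" for u v
    using descending_leading[OF that(1) _ that(2)] E' by blast
  show "v = u" if uv: "u \<in> ?S" "v \<in> ?S" and sub: "sublist v u" for u v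
  proof -
    have len: "length v \<le> length u" using sub by (rule sublist_length_le)
    show ?thesis
      using uv
    proof (elim UnE)
      assume "u \<in> descending n" "v \<in> descending n"
      then show ?thesis using sublist_same_length[OF sub] desc(1) by simp
    next
      assume u: "u \<in> descending n" and "v \<in> E"
      from \<open>v \<in> E\<close> have "v = [n+1, 1]" by (rule E')
      then obtain a b where ab: "u = a @ [n+1, 1] @ b" using sub by (auto simp: sublist_def)
      have "\<forall>x\<in>set a. x > n + 1" "\<forall>x\<in>set b. x < 1"
        using desc(3)[OF u] by (auto simp: ab sorted_wrt_append)
      moreover have "set a \<subseteq> D" "set b \<subseteq> D" using desc(2)[OF u] by (auto simp: ab)
      ultimately have "a = [] \<and> b = []" by (cases a; cases b; force)
      then show ?thesis using desc(1)[OF u] n by (simp add: ab)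
    next
      assume "u \<in> E" "v \<in> descending n"
      then show ?thesis using len desc(1)[of v] n E'[of u] by simp
    next
      assume "u \<in> E" "v \<in> E"
      then show ?thesis using E' by blast
    qed
  qed
  show "gen_desc (p @ y) * mon z - mon p * gen_desc (y @ z) \<in> word_system.lower ?S gen_desc (p @ y @ z)"
    if py: "p @ y \<in> ?S" and yz: "y @ z \<in> ?S" and ne: "p \<noteq> []" "y \<noteq> []" "z \<noteq> []" for p y z
  proof -
    from ne obtain x where x: "x \<in> set y" by (cases y) auto
    consider (main) "p @ y \<in> descending n" "y @ z \<in> descending n"
      | (left) "p @ y \<in> descending n" "y @ z = [n+1, 1]"
      | (right) "p @ y = [n+1, 1]" "y @ z \<in> descending n"
      | (both) "p @ y = [n+1, 1]" "y @ z = [n+1, 1]"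
      using py yz E' by blast
    then show ?thesis
    proof cases
      case main
      have "\<forall>a\<in>set p. \<forall>b\<in>set z. a > b"
        using desc(3)[OF \<open>p @ y \<in> descending n\<close>] desc(3)[OF \<open>y @ z \<in> descending n\<close>] x
        by (force simp: sorted_wrt_append)
      then have sorted: "sorted_wrt (>) (p @ y @ z)"
        using desc(3)[OF \<open>p @ y \<in> descending n\<close>] desc(3)[OF \<open>y @ z \<in> descending n\<close>]
        by (auto simp: sorted_wrt_append)
      have sub: "set (p @ y @ z) \<subseteq> D"
        using desc(2)[OF \<open>p @ y \<in> descending n\<close>] desc(2)[OF \<open>y @ z \<in> descending n\<close>] by auto
      have len: "length p + length y = n" "length y + length z = n"
        using desc(1)[OF \<open>p @ y \<in> descending n\<close>] desc(1)[OF \<open>y @ z \<in> descending n\<close>] by auto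
      have "length (p @ y @ z) = card (set (p @ y @ z))"
        using descending_distinct[OF sorted] by (simp only: distinct_card)
      also have "\<dots> \<le> card D" by (rule card_mono[OF _ sub]) simp
      finally have "length (p @ y @ z) \<le> n + 1" by simp
      with len ne have one: "length z = 1" "length p = 1" by (auto simp flip: length_greater_0_conv)
      have "set (p @ y @ z) = D"
        using card_subset_eq[OF _ sub] descending_distinct[OF sorted] len one by (simp add: distinct_card del: set_append)
      then have full: "p @ y @ z = full_word"
        using sorted by (intro descending_eqI sorted_full_word) (simp_all only: set_full_word)
      from one obtain c d where cd: "z = [c]" "p = [d]"
        by (auto simp: length_Suc_conv)
      have "(p @ y) @ [c] = rev [2..<n+2] @ [1]" using full by (simp only: full_word_eq(2) cd append_assoc)
      then have z: "p @ y = rev [2..<n+2]" "z = [1]" by (simp_all only: append1_eq_conv cd)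
      have "d # y @ z = (n + 1) # rev [1..<n+1]" using full by (simp only: full_word_eq(1) cd append_Cons append_Nil)
      then have p: "p = [n+1]" "y @ z = rev [1..<n+1]" by (simp_all only: list.inject cd)
      have "gen_desc (p @ y) = G 1" "gen_desc (y @ z) = G (n+1)"
        using len by (intro gen_desc_eq_G; force simp: z(1) p(2) simp del: upt_Suc)+
      moreover have "G 1 * mon [1] - mon [n+1] * G (n+1) \<in> word_system.lower ?S gen_desc full_word"
      proof (rule composition_in_subspace)
        show "P.subspace (word_system.lower ?S gen_desc full_word)"
          by (simp add: word_system.lower_def)
        fix i assume i: "i \<in> D"
        then have S: "rev (omit n i) \<in> ?S" by (simp add: descending_eq)
        show "mon [i] * G i \<in> word_system.lower ?S gen_desc full_word" if "i \<le> n"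
          using word_system.lower_base[OF S, of "[i]" "[]" full_word gen_desc] i that
            word_less_full(1)[OF desc_in_perms i] by (simp add: gen_desc_omit mon_Nil)
        show "G i * mon [i] \<in> word_system.lower ?S gen_desc full_word" if "2 \<le> i"
          using word_system.lower_base[OF S, of "[]" "[i]" full_word gen_desc] i that
            word_less_full(2)[OF desc_in_perms i] by (simp add: gen_desc_omit mon_Nil)
      next
        show "commutators \<in> word_system.lower ?S gen_desc full_word"
          using E
        proof (elim disjE conjE)
          assume "commutators = 0"
          then show ?thesis by (simp add: word_system.lower_def P.span_zero)
        next
          assume *: "E = {[n+1, 1]}" "commutators = - (mon [n+1, 1] - mon [1, n+1])"
          have "[n+1, 1] \<prec> full_word"
            using n by (simp add: word_less_def lenlex_conv full_word_def del: upt_Suc)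
          then have "gen_desc [n+1, 1] \<in> word_system.lower ?S gen_desc full_word"
            using word_system.lower_base[of "[n+1, 1]" ?S "[]" "[]" full_word gen_desc] *(1)
            by (simp add: mon_Nil)
          then have "- gen_desc [n+1, 1] \<in> word_system.lower ?S gen_desc full_word"
            unfolding word_system.lower_def by (rule P.span_neg)
          then show ?thesis by (simp add: *(2) gen_desc_def)
        qed
      qed
      ultimately show ?thesis unfolding full by (simp add: z(2) p(1))
    next
      case left
      then have "y = [n+1]" using ne by (cases y; cases "tl y") auto
      then obtain a where "a \<in> set p" "a > n + 1"
        using desc(3)[OF left(1)] ne by (cases p) (auto simp: sorted_wrt_append)
      then show ?thesis using desc(2)[OF left(1)] by auto
    next
      case right
      then have "y = [1]" using ne by (cases p; cases "tl p") auto
      then obtain a where "a \<in> set z" "a < 1"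
        using desc(3)[OF right(2)] ne by (cases z) (auto simp: sorted_wrt_append)
      then show ?thesis using desc(2)[OF right(2)] by auto
    next
      case both
      then have "y = [1]" "y = [n+1]" using ne by (cases p; cases "tl p"; cases y; cases "tl y"; auto)+
      then show ?thesis using n by simp
    qed
  qed
qed

lemma descending_multiples:
  assumes E: "E = {} \<or> E = {[n+1, 1]} \<and> commutators = - (mon [n+1, 1] - mon [1, n+1])"
  shows "multiples D (gen_desc ` (descending n \<union> E)) = multiples D (G ` D)"
proof -
  have eq: "gen_desc ` descending n = G ` D"
    unfolding descending_eq image_image using gen_desc_omit by (rule image_cong[OF refl])
  have base: "H \<subseteq> multiples D H" for H :: "(nat list \<Rightarrow>\<^sub>0 'a) set"
    using multiples_base[of _ H "[]" D "[]"] by (auto simp: mon_Nil)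
  have "gen_desc w \<in> multiples D (G ` D)" if "w \<in> E" for w
  proof -
    have *: "w = [n+1, 1]" "commutators = - (mon [n+1, 1] - mon [1, n+1])" using that E by auto
    have "gen_desc w = - commutators" by (simp add: * gen_desc_def)
    then show ?thesis
      using P.subspace_neg[OF multiples_subspace commutators_multiple] by simp
  qed
  then show ?thesis
    using base[of "G ` D"] base[of "gen_desc ` (descending n \<union> E)"]
    by (intro multiples_eqI) (auto simp: image_Un eq simp del: atLeastAtMost_iff)
qed

end


section \<open>Relations modulo the commutator of the first two letters\<close>

definition adjacent_12 :: "nat list \<Rightarrow> bool" where
  "adjacent_12 v \<longleftrightarrow> sublist [1, 2] v \<or> sublist [2, 1] v"

lemma adjacent_12_Cons: "adjacent_12 v \<Longrightarrow> adjacent_12 (x # v)"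
  by (auto simp: adjacent_12_def sublist_Cons_right)

lemma adjacent_12_append: "adjacent_12 (a @ [1, 2] @ b)" "adjacent_12 (a @ [2, 1] @ b)"
  unfolding adjacent_12_def by blast+

lemma not_adjacent_12:
  assumes "distinct (P @ [2, a, 1])"
  shows "\<not> adjacent_12 (P @ [2, a, 1])"
proof
  assume "adjacent_12 (P @ [2, a, 1])"
  then consider c d where "P @ 2 # [a, 1] = c @ 2 # 1 # d" | c d where "(P @ [2, a]) @ 1 # [] = c @ 1 # 2 # d"
    by (auto simp: adjacent_12_def sublist_def)
  then show False
  proof cases
    case 1
    have "2 \<notin> set P" "2 \<notin> set [a, 1]" using assms by auto
    from iffD1[OF append_Cons_eq_iff[OF this] 1] have "[a, 1] = 1 # d" by (rule conjunct2)
    then show False using assms by auto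
  next
    case 2
    have "1 \<notin> set (P @ [2, a])" "1 \<notin> set []" using assms by auto
    from iffD1[OF append_Cons_eq_iff[OF this] 2] have "[] = 2 # d" by (rule conjunct2)
    then show False by simp
  qed
qed

text \<open>
  In the descending word the letters 2 and 1 stand at the end. The cheapest way to separate them is to
  move 2 in front of the letter \<open>a\<close> before it.
\<close>

lemma nonadjacent_word_max:
  "sorted_wrt (>) (P @ [a, 2, 1]) \<Longrightarrow> mset v = mset (P @ [a, 2, 1]) \<Longrightarrow> \<not> adjacent_12 v \<Longrightarrow>
    v \<noteq> P @ [2, a, 1] \<Longrightarrow> v \<prec> P @ [2, a, 1]"
proof (induction P arbitrary: v)
  case Nil
  then have a: "a > 2" by simp
  have "length v = 3" using arg_cong[OF Nil(2), of size] by simp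
  then obtain x y z where v: "v = [x, y, z]" by (auto simp: length_Suc_conv eval_nat_numeral)
  have "\<not> (x = a \<and> y = 1 \<and> z = 2)" "\<not> (x = a \<and> y = 2 \<and> z = 1)"
    "\<not> (x = 1 \<and> y = 2)" "\<not> (x = 2 \<and> y = 1)"
    using Nil(3) adjacent_12_append[of "[a]" "[]"] adjacent_12_append[of "[]" "[z]"] by (auto simp: v)
  moreover have "set v = set ([] @ [a, 2, 1])" by (rule mset_eq_setD[OF Nil(2)])
  then have "x = a \<or> x = 2 \<or> x = 1" "y = a \<or> y = 2 \<or> y = 1" "z = a \<or> z = 2 \<or> z = 1"
    by (auto simp: v)
  moreover have "distinct v" using mset_eq_imp_distinct_iff[OF Nil(2)] a by simp
  then have "x \<noteq> y" "x \<noteq> z" "y \<noteq> z" by (simp_all add: v)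
  ultimately have "x = 2 \<and> y = a \<and> z = 1 \<or> x = 1 \<and> y = a \<and> z = 2"
    using a by (elim disjE) simp_all
  then have "v = [2, a, 1] \<or> v = [1, a, 2]" unfolding v by blast
  then show ?case using Nil(4) by (auto simp: word_less_def Cons_lenlex_iff)
next
  case (Cons p P)
  then obtain y v' where v: "v = y # v'" by (cases v) auto
  then have len: "length v' = length (P @ [a, 2, 1])" using arg_cong[OF Cons(3), of size] by simp
  show ?case
  proof (cases "y = p")
    case True
    then have "v' \<prec> P @ [2, a, 1]"
      using Cons.prems adjacent_12_Cons[of v' y] by (intro Cons.IH) (auto simp: v)
    with True v len show ?thesis by (simp add: word_less_def Cons_lenlex_iff)
  next
    case False
    have "y \<in> set ((p # P) @ [a, 2, 1])" using Cons(3) v by (metis list.set_intros(1) mset_eq_setD)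
    with False Cons(2) have "y < p" by auto
    with v len show ?thesis by (simp add: word_less_def Cons_lenlex_iff)
  qed
qed

definition comm_21 :: "nat list \<Rightarrow>\<^sub>0 'a::field" where "comm_21 = mon [2, 1] - mon [1, 2]"

text \<open>
  These pairs parametrise the arrangements of \<open>A\<close> with 2 immediately before 1, and, after exchanging
  the two letters, those with 1 immediately before 2.
\<close>

definition splits_21 :: "nat set \<Rightarrow> (nat list \<times> nat list) set" where
  "splits_21 A = {(a, b). a @ [2, 1] @ b \<in> permutations_of_set A}"

lemma finite_splits_21: "finite A \<Longrightarrow> finite (splits_21 A)"
proof -
  assume "finite A"
  have "inj_on (\<lambda>(a, b). a @ [2, 1] @ b) (splits_21 A)"
    by (auto simp: inj_on_def splits_21_def permutations_of_set_def append_Cons_eq_iff)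
  moreover have "(\<lambda>(a, b). a @ [2, 1] @ b) ` splits_21 A \<subseteq> permutations_of_set A"
    by (auto simp: splits_21_def)
  ultimately show ?thesis
    using inj_on_finite \<open>finite A\<close> finite_permutations_of_set by blast
qed

text \<open>
  Exchanging adjacent letters 1 and 2 changes the sign of an arrangement, so that the terms in which
  they are adjacent combine in pairs to multiples of the commutator.
\<close>

lemma alternating_sum_split_adjacent:
  fixes k :: "'a::field"
  assumes "finite A"
  shows "(\<Sum>v\<in>permutations_of_set A. scl (k * of_int (word_sign v)) (mon v))
    = (\<Sum>v\<in>{v \<in> permutations_of_set A. \<not> adjacent_12 v}. scl (k * of_int (word_sign v)) (mon v))
    + (\<Sum>(a, b)\<in>splits_21 A. scl (k * of_int (word_sign (a @ [2, 1] @ b))) (mon a * comm_21 * mon b))"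
proof -
  let ?f = "\<lambda>v. scl (k * of_int (word_sign v)) (mon v)" and ?P = "permutations_of_set A"
  let ?T = "splits_21 A" and ?g = "\<lambda>(a, b). a @ [2, 1] @ b" and ?h = "\<lambda>(a, b). a @ [1, 2] @ b"
  let ?N = "{v \<in> ?P. \<not> adjacent_12 v}"
  have swap: "a @ [2, 1] @ b \<in> ?P \<longleftrightarrow> a @ [1, 2] @ b \<in> ?P" for a b
    by (auto simp: permutations_of_set_def)
  have P: "?P = ?N \<union> (?g ` ?T \<union> ?h ` ?T)"
  proof (intro equalityI subsetI)
    fix v assume v: "v \<in> ?P"
    show "v \<in> ?N \<union> (?g ` ?T \<union> ?h ` ?T)"
    proof (cases "adjacent_12 v")
      case True
      then obtain a b where "v = a @ [1, 2] @ b \<or> v = a @ [2, 1] @ b"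
        unfolding adjacent_12_def sublist_def by blast
      with v swap[of a b] have "(a, b) \<in> ?T \<and> (v = ?g (a, b) \<or> v = ?h (a, b))"
        unfolding splits_21_def by auto
      then show ?thesis by blast
    qed (use v in blast)
  next
    fix v assume "v \<in> ?N \<union> (?g ` ?T \<union> ?h ` ?T)"
    then show "v \<in> ?P" using swap unfolding splits_21_def by auto
  qed
  have fin: "finite ?P" "finite ?T" using assms by (simp_all add: finite_splits_21)
  have distinct: "distinct (a @ [2, 1] @ b)" "distinct (a @ [1, 2] @ b)" if "(a, b) \<in> ?T" for a b
    using that by (auto simp: splits_21_def permutations_of_set_def)
  have inj: "inj_on ?g ?T" "inj_on ?h ?T"
    by (auto simp: inj_on_def splits_21_def permutations_of_set_def append_Cons_eq_iff)
  have disj1: "?N \<inter> (?g ` ?T \<union> ?h ` ?T) = {}"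
    using adjacent_12_append by auto
  have disj2: "?g ` ?T \<inter> ?h ` ?T = {}"
  proof -
    have False if T: "(a, b) \<in> ?T" "(c, d) \<in> ?T" and eq: "a @ [2, 1] @ b = c @ [1, 2] @ d" for a b c d
    proof -
      have "a = c @ [1]"
        using append_Cons_eq_iff[of 2 a "1 # b" "c @ [1]" d] eq distinct[OF T(1)] by simp
      then show False using distinct[OF T(1)] by simp
    qed
    then show ?thesis by (auto simp del: append_Cons)
  qed
  have "sum ?f ?P = sum ?f ?N + (sum ?f (?g ` ?T) + sum ?f (?h ` ?T))"
  proof -
    have "sum ?f ?P = sum ?f (?N \<union> (?g ` ?T \<union> ?h ` ?T))" using P by simp
    also have "\<dots> = sum ?f ?N + sum ?f (?g ` ?T \<union> ?h ` ?T)"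
      using fin disj1 by (intro sum.union_disjoint) auto
    also have "sum ?f (?g ` ?T \<union> ?h ` ?T) = sum ?f (?g ` ?T) + sum ?f (?h ` ?T)"
      using fin disj2 by (intro sum.union_disjoint) auto
    finally show ?thesis .
  qed
  also have "sum ?f (?g ` ?T) + sum ?f (?h ` ?T) = (\<Sum>x\<in>?T. ?f (?g x) + ?f (?h x))"
    by (simp only: sum.reindex[OF inj(1)] sum.reindex[OF inj(2)] comp_def sum.distrib)
  also have "\<dots> = (\<Sum>(a, b)\<in>?T. scl (k * of_int (word_sign (a @ [2, 1] @ b))) (mon a * comm_21 * mon b))"
  proof (intro sum.cong refl, clarify)
    fix a b assume "(a, b) \<in> ?T"
    from word_sign_swap[of a 2 1 b] distinct(1)[OF this]
    have "word_sign (a @ [1, 2] @ b) = - word_sign (a @ [2, 1] @ b)" by simp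
    then show "?f (a @ [2, 1] @ b) + ?f (a @ [1, 2] @ b)
        = scl (k * of_int (word_sign (a @ [2, 1] @ b))) (mon a * comm_21 * mon b)"
      by (simp add: comm_21_def right_diff_distrib left_diff_distrib mon_mult P.scale_minus_left
          P.scale_right_diff_distrib)
  qed
  finally show ?thesis .
qed

context even_envelope
begin

text \<open>
  For \<open>i \<ge> 3\<close> the smallest letters other than \<open>i\<close> are 1, 2 and \<open>third i\<close>.
\<close>

definition third :: "nat \<Rightarrow> nat" where "third i = (if i = 3 then 4 else 3)"

text \<open>
  For \<open>i \<ge> 3\<close> these are the letters other than \<open>i\<close> above the three smallest ones.
\<close>

definition prefix_2b :: "nat \<Rightarrow> nat list" where
  "prefix_2b i = (if i = 3 then rev [5..<n+2] else rev (filter (\<lambda>j. j \<noteq> i) [4..<n+2]))"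

definition word_2b :: "nat \<Rightarrow> nat list" where
  "word_2b i = (if i \<le> 2 then rev (omit n i) else prefix_2b i @ [2, third i, 1])"

lemma rev_omit_2b:
  assumes "3 \<le> i"
  shows "rev (omit n i) = prefix_2b i @ [third i, 2, 1]"
proof -
  define K where "K = [5..<n+2]"
  have upt: "[4..<n+2] = 4 # K" "[1..<n+2] = [1, 2, 3] @ 4 # K"
    using n by (simp_all add: K_def upt_conv_Cons eval_nat_numeral del: upt_Suc)
  have "filter (\<lambda>j. j \<noteq> 3) K = K" by (auto simp: filter_id_conv K_def simp del: upt_Suc)
  then show ?thesis using assms unfolding omit_def prefix_2b_def third_def upt K_def[symmetric]
    by (cases "i = 3") simp_all
qed

lemma omit_1_2: "rev (omit n 1) = rev [2..<n+2]" "rev (omit n 2) = rev [3..<n+2] @ [1]"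
proof -
  define K where "K = [3..<n+2]"
  have upt: "[2..<n+2] = 2 # K" "[1..<n+2] = [1, 2] @ K"
    using n by (simp_all add: K_def upt_conv_Cons eval_nat_numeral del: upt_Suc)
  have "filter (\<lambda>j. j \<noteq> 1) K = K" "filter (\<lambda>j. j \<noteq> 2) K = K"
    by (auto simp: filter_id_conv K_def simp del: upt_Suc)
  then show "rev (omit n 1) = rev [2..<n+2]" "rev (omit n 2) = rev [3..<n+2] @ [1]"
    unfolding omit_def upt K_def[symmetric] by simp_all
qed

lemma forbidden_2b_eq: "forbidden_2b n = insert [2, 1] (word_2b ` D)"
proof -
  have "D = {1, 2, 3} \<union> {4..n+1}" using n by auto
  then have "word_2b ` D = {word_2b 1, word_2b 2, word_2b 3} \<union> word_2b ` {4..n+1}" by auto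
  moreover have "word_2b 1 = rev [2..<n+2]" "word_2b 2 = rev [3..<n+2] @ [1]"
    "word_2b 3 = rev [5..<n+2] @ [2, 4, 1]"
    using omit_1_2 by (simp_all add: word_2b_def prefix_2b_def third_def del: upt_Suc)
  moreover have "word_2b ` {4..n+1} = (\<lambda>i. rev (filter (\<lambda>j. j \<noteq> i) [4..<n+2]) @ [2, 3, 1]) ` {4..n+1}"
    by (intro image_cong refl) (simp add: word_2b_def prefix_2b_def third_def del: upt_Suc)
  ultimately show ?thesis by (simp only: forbidden_2b_def Un_insert_left Un_empty_left)
qed

lemma word_2b_perm: "word_2b i \<in> permutations_of_set (D - {i})"
proof (cases "i \<le> 2")
  case True
  then show ?thesis using desc_in_perms by (simp add: word_2b_def)
next
  case False
  then show ?thesis using desc_in_perms[of i] rev_omit_2b[of i]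
    by (auto simp: word_2b_def permutations_of_set_def simp del: atLeastAtMost_iff)
qed

lemma word_2b: "set (word_2b i) = D - {i}" "distinct (word_2b i)"
  using word_2b_perm[of i] by (simp_all only: permutations_of_set_def mem_Collect_eq)

lemma length_word_2b: "i \<in> D \<Longrightarrow> length (word_2b i) = n"
  using distinct_card[OF word_2b(2)[of i]] unfolding word_2b(1) by simp

text \<open>
  For \<open>Y i = 0\<close> this is the negative of \<open>G i\<close> without the terms in which 1 and 2 are adjacent. The
  sign makes the leading coefficient 1 for \<open>i \<ge> 3\<close>: the new leading word then arises from the old one
  by exchanging two letters.
\<close>

definition reduced_G :: "nat \<Rightarrow> (nat list \<Rightarrow>\<^sub>0 'a)" where
  "reduced_G i = (\<Sum>v\<in>{v \<in> permutations_of_set (D - {i}). \<not> adjacent_12 v}.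
     scl (- \<sigma> * of_int (word_sign v)) (mon v))"

definition gen_2b :: "nat list \<Rightarrow> (nat list \<Rightarrow>\<^sub>0 'a)" where
  "gen_2b w = (if w = [2, 1] then comm_21
     else if missing w \<le> 2 then G (missing w) else reduced_G (missing w))"

lemma gen_2b_word: "i \<in> D \<Longrightarrow> gen_2b (word_2b i) = (if i \<le> 2 then G i else reduced_G i)"
proof -
  assume i: "i \<in> D"
  have "word_2b i \<noteq> [2, 1]"
  proof
    assume "word_2b i = [2, 1]"
    then have "length (word_2b i) = 2" by simp
    with length_word_2b[OF i] n show False by simp
  qed
  then show ?thesis by (simp only: gen_2b_def missing_eq[OF i word_2b(1)] if_False)
qed

lemma gen_2b_21: "gen_2b [2, 1] = comm_21" "gen_2b [2, Suc 0] = comm_21"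
  by (simp_all add: gen_2b_def)

lemma G_reduced:
  assumes "Y i = 0"
  shows "G i = - reduced_G i + (\<Sum>(a, b)\<in>splits_21 (D - {i}).
     scl (\<sigma> * of_int (word_sign (a @ [2, 1] @ b))) (mon a * comm_21 * mon b))"
  unfolding G_expand assms reduced_G_def
  by (subst alternating_sum_split_adjacent) (simp_all add: P.scale_minus_left sum_negf)

lemma nonadjacent_word_2b: "3 \<le> i \<Longrightarrow> \<not> adjacent_12 (word_2b i)"
  using not_adjacent_12[of "prefix_2b i" "third i"] word_2b(2)[of i] by (simp add: word_2b_def)

lemma leading_reduced_G:
  assumes i: "i \<in> D" "3 \<le> i" and v: "v \<in> Poly_Mapping.keys (reduced_G i - mon (word_2b i))"
  shows "v \<prec> word_2b i \<and> set v \<subseteq> D"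
proof -
  let ?w = "word_2b i" and ?N = "{v \<in> permutations_of_set (D - {i}). \<not> adjacent_12 v}"
  let ?L = "{v. v \<prec> ?w \<and> set v \<subseteq> D}"
  have eq: "?w = prefix_2b i @ [2, third i, 1]" using i(2) by (simp add: word_2b_def)
  have w: "?w \<in> ?N" using word_2b_perm nonadjacent_word_2b[OF i(2)] by blast
  have "distinct (prefix_2b i @ third i # 2 # [1])"
    using distinct_omit[of n i] rev_omit_2b[OF i(2)] by (metis distinct_rev)
  then have "word_sign ?w = - word_sign (rev (omit n i))"
    unfolding eq rev_omit_2b[OF i(2)] by (rule word_sign_swap)
  then have one: "- \<sigma> * of_int (word_sign ?w) = 1"
    using word_sign_desc[OF i(1)] \<sigma>_square by simp
  have "reduced_G i = mon ?w + (\<Sum>v\<in>?N - {?w}. scl (- \<sigma> * of_int (word_sign v)) (mon v))"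
    unfolding reduced_G_def using w by (subst sum.remove[of _ ?w]) (simp_all only: one, simp_all)
  then have "reduced_G i - mon ?w = (\<Sum>v\<in>?N - {?w}. scl (- \<sigma> * of_int (word_sign v)) (mon v))"
    by simp
  also have "\<dots> \<in> P.span (mon ` ?L)"
  proof (intro P.span_sum P.span_scale)
    fix v assume v: "v \<in> ?N - {?w}"
    then have set_v: "set v = D - {i}" "distinct v" unfolding permutations_of_set_def by blast+
    have "v \<prec> prefix_2b i @ [2, third i, 1]"
    proof (rule nonadjacent_word_max)
      show "sorted_wrt (>) (prefix_2b i @ [third i, 2, 1])"
        using strict_sorted_omit[of n i] unfolding rev_omit_2b[OF i(2), symmetric] by (simp add: sorted_wrt_rev)
      show "mset v = mset (prefix_2b i @ [third i, 2, 1])"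
        unfolding rev_omit_2b[OF i(2), symmetric]
        using set_v by (subst set_eq_iff_mset_eq_distinct[symmetric])
          (simp_all only: set_rev set_omit distinct_rev distinct_omit)
    qed (use v eq in auto)
    then have "v \<prec> ?w" using eq by simp
    moreover have "set v \<subseteq> D" using set_v by blast
    ultimately show "mon v \<in> P.span (mon ` ?L)" by (intro P.span_base) blast
  qed
  finally show ?thesis using keys_in_span_mon v by blast
qed

lemma leading_2b:
  assumes "u \<in> forbidden_2b n" "v \<in> Poly_Mapping.keys (gen_2b u - mon u)"
  shows "v \<prec> u \<and> set v \<subseteq> D"
proof -
  consider "u = [2, 1]" | i where "i \<in> D" "u = word_2b i"
    using assms(1) unfolding forbidden_2b_eq by blast
  then show ?thesis
  proof cases
    case 1
    then have "gen_2b u - mon u = - mon [1, 2]" by (simp add: gen_2b_def comm_21_def)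
    then have "v = [1, 2]" using assms(2) by (simp add: mon_def split: if_splits)
    then show ?thesis using 1 n by (simp add: word_less_def Cons_lenlex_iff)
  next
    case (2 i)
    show ?thesis
    proof (cases "i \<le> 2")
      case True
      have "gen_2b u = G i" using True 2(2) gen_2b_word[OF 2(1)] by simp
      moreover have "u = rev (omit n i)" using True 2(2) by (simp add: word_2b_def)
      ultimately have "u = rev (omit n i)" "gen_2b u = G i" by simp_all
      then show ?thesis using leading_G[OF 2(1)] assms(2) by simp
    next
      case False
      then show ?thesis using leading_reduced_G[OF 2(1), of v] assms(2) gen_2b_word[OF 2(1)] 2(2) by simp
    qed
  qed
qed

lemma factor_free_2b:
  assumes "u \<in> forbidden_2b n" "v \<in> forbidden_2b n" "sublist v u"
  shows "v = u"
proof -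
  have no_21: "\<not> sublist [2, 1] (word_2b i)" if "i \<in> D" for i
  proof (cases "i \<le> 2")
    case True
    then have "i = 1 \<or> i = 2" using that by auto
    then have "\<not> {1, 2} \<subseteq> set (word_2b i)" unfolding word_2b(1) by blast
    then show ?thesis using set_mono_sublist[of "[2, 1]" "word_2b i"] by auto
  next
    case False
    then show ?thesis using nonadjacent_word_2b[of i] unfolding adjacent_12_def by simp
  qed
  have len: "length v \<le> length u" using assms(3) by (rule sublist_length_le)
  show ?thesis
    using assms(1,2) unfolding forbidden_2b_eq
  proof (elim insertE imageE)
    fix i j assume "i \<in> D" "j \<in> D" "u = word_2b i" "v = word_2b j"
    then show ?thesis using sublist_same_length[OF assms(3)] length_word_2b by simp
  next
    fix i assume "i \<in> D" "u = word_2b i" "v = [2, 1]"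
    then show ?thesis using no_21 assms(3) by simp
  next
    fix i assume "i \<in> D" "v = word_2b i" "u = [2, 1]"
    then show ?thesis using len length_word_2b n by simp
  qed simp
qed

lemma hd_word_2b:
  assumes "i \<in> D"
  shows "hd (word_2b i) = (if i = n + 1 then n else n + 1)"
proof -
  consider "i = 1" | "i = 2" | "i = 3" | "4 \<le> i" "i \<le> n" | "i = n + 1" using assms by fastforce
  then show ?thesis
  proof cases
    case 1 then show ?thesis using n omit_1_2(1) by (simp add: word_2b_def)
  next
    case 2 then show ?thesis using n omit_1_2(2) by (simp add: word_2b_def)
  next
    case 3 then show ?thesis using n by (simp add: word_2b_def prefix_2b_def)
  next
    case 4 then show ?thesis using n by (simp add: word_2b_def prefix_2b_def)
  next
    case 5
    have "[4..<n+1] = [4..<n] @ [n]" using n by simp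
    then show ?thesis using 5 n by (simp add: word_2b_def prefix_2b_def)
  qed
qed

lemma last_word_2b:
  assumes "i \<in> D" "i \<noteq> 1"
  shows "\<exists>v. word_2b i = v @ [1]"
  using assms omit_1_2(2) by (cases "i = 2") (auto simp: word_2b_def)

lemma one_at_end_2b:
  assumes "y @ z \<in> forbidden_2b n" "z \<noteq> []"
  shows "1 \<notin> set y"
proof
  assume one: "1 \<in> set y"
  consider "y @ z = [2, 1]" | i where "i \<in> D" "y @ z = word_2b i" using assms(1) forbidden_2b_eq by blast
  then show False
  proof cases
    case 1
    then show False using one assms(2) by (cases y; cases "tl y") auto
  next
    case (2 i)
    then have "i \<noteq> 1" using one word_2b(1)[of 1] by (metis DiffD2 Un_iff set_append singletonI)
    then obtain v where v: "y @ z = v @ [1]" using last_word_2b 2 by auto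
    have "z = butlast z @ [1]" using arg_cong[OF v, of last] assms(2) by (metis append_butlast_last_id last_appendR last_snoc)
    then have "1 \<in> set z" by (metis in_set_conv_decomp)
    then show False using one word_2b(2)[of i] 2 by (metis distinct_append disjoint_iff)
  qed
qed

text \<open>
  A leading word other than \<open>x\<^sub>n\<^sub>+\<^sub>1 \<dots> x\<^sub>2\<close> ends with 1, but 1 occurs in a leading word only as its last
  letter, so that it cannot belong to the part \<open>y\<close>. Hence \<open>p y = x\<^sub>n\<^sub>+\<^sub>1 \<dots> x\<^sub>2\<close>, and \<open>y = x\<^sub>k\<^sub>+\<^sub>1 \<dots> x\<^sub>2\<close>
  begins with at most \<open>x\<^sub>n\<close>. Of the leading words of length \<open>n\<close> only \<open>x\<^sub>n \<dots> x\<^sub>4 x\<^sub>2 x\<^sub>3 x\<^sub>1\<close> does not begin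
  with \<open>x\<^sub>n\<^sub>+\<^sub>1\<close>, and its last letter but one is not \<open>x\<^sub>2\<close>; so only \<open>y z = x\<^sub>2 x\<^sub>1\<close> is left.
\<close>

lemma overlap_2b:
  assumes py: "p @ y \<in> forbidden_2b n" and yz: "y @ z \<in> forbidden_2b n"
    and ne: "p \<noteq> []" "y \<noteq> []" "z \<noteq> []"
  shows "p = rev [3..<n+2] \<and> y = [2] \<and> z = [1]"
proof -
  have "1 \<notin> set y" using one_at_end_2b yz ne by blast
  have py1: "p @ y = word_2b 1"
  proof (rule ccontr)
    assume "p @ y \<noteq> word_2b 1"
    then have "\<exists>v. p @ y = v @ [1]" using py last_word_2b unfolding forbidden_2b_eq
      by (metis append.left_neutral append_Cons imageE insertE)
    then have "last y = 1" using ne by (metis last_appendR last_snoc)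
    then show False using \<open>1 \<notin> set y\<close> ne last_in_set by metis
  qed
  define k where "k = length y"
  have "rev y @ rev p = [2..<n+2]" using arg_cong[OF py1, of rev] omit_1_2(1) by (simp add: word_2b_def)
  then have "rev y = take k [2..<n+2]" by (metis append_eq_conv_conj k_def length_rev)
  moreover have "length p + k = n"
    using length_word_2b[of 1] unfolding py1[symmetric] k_def by simp
  then have k: "1 \<le> k" "k < n"
    using ne by (auto simp: k_def Suc_le_eq simp flip: length_greater_0_conv)
  ultimately have "rev y = [2..<2+k]" by (simp add: take_upt del: upt_Suc)
  then have y: "y = rev [2..<2+k]" by (metis rev_rev_ident)
  have y': "hd y = 1 + k" "last y = 2" using k by (simp_all add: y hd_rev last_rev del: upt_Suc)
  consider "y @ z = [2, 1]" | i where "i \<in> D" "y @ z = word_2b i" using yz forbidden_2b_eq by blast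
  then show ?thesis
  proof cases
    case 1
    then have "y = [2]" "z = [1]" using ne by (cases y; cases "tl y"; simp)+
    moreover have "[2..<n+2] = 2 # [3..<n+2]"
      using n by (simp add: upt_conv_Cons eval_nat_numeral del: upt_Suc)
    then have "p @ y = rev [3..<n+2] @ [2]"
      using py1 omit_1_2(1) by (simp add: word_2b_def del: upt_Suc)
    ultimately show ?thesis by (simp del: upt_Suc)
  next
    case (2 i)
    then have "hd y = (if i = n + 1 then n else n + 1)" using hd_word_2b ne by (metis hd_append2)
    then have i: "i = n + 1" "k = n - 1" using y' k by (auto split: if_splits)
    have "k + length z = n" using length_word_2b[OF 2(1)] unfolding 2(2)[symmetric] k_def by simp
    then have "length z = 1" using i n by simp
    then obtain c where "z = [c]" by (auto simp: length_Suc_conv)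
    moreover have "word_2b i = (prefix_2b i @ [2, 3]) @ [1]" using i n by (simp add: word_2b_def third_def)
    ultimately have "y = prefix_2b i @ [2, 3]" using 2 by simp
    then show ?thesis using y' by simp
  qed
qed

abbreviation "S2b \<equiv> forbidden_2b n"
abbreviation "lower_2b \<equiv> word_system.lower S2b gen_2b"

lemma lower_2b_subspace: "P.subspace (lower_2b W)"
  by (simp add: word_system.lower_def)

lemma comm_in_lower_2b:
  assumes "\<And>c d. (c, d) \<in> T \<Longrightarrow> (a @ c) @ [2, 1] @ (d @ b) \<prec> W"
  shows "mon a * (\<Sum>(c, d)\<in>T. scl (k c d) (mon c * comm_21 * mon d)) * mon b \<in> lower_2b W"
proof -
  have "mon a * (\<Sum>(c, d)\<in>T. scl (k c d) (mon c * comm_21 * mon d)) * mon b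
      = (\<Sum>(c, d)\<in>T. scl (k c d) (mon (a @ c) * gen_2b [2, 1] * mon (d @ b)))"
    unfolding sum_distrib_left sum_distrib_right
    by (intro sum.cong refl) (auto simp: mult_scl gen_2b_21 mon_mult[symmetric] mult.assoc)
  also have "\<dots> \<in> lower_2b W"
  proof (intro P.subspace_sum[OF lower_2b_subspace], clarify)
    fix c d assume "(c, d) \<in> T"
    then have "mon (a @ c) * gen_2b [2, 1] * mon (d @ b) \<in> lower_2b W"
      using assms forbidden_2b_eq by (intro word_system.lower_base) auto
    then show "scl (k c d) (mon (a @ c) * gen_2b [2, 1] * mon (d @ b)) \<in> lower_2b W"
      by (rule P.subspace_scale[OF lower_2b_subspace])
  qed
  finally show ?thesis .
qed

lemma splits_21_perm: "(c, d) \<in> splits_21 A \<Longrightarrow> c @ [2, 1] @ d \<in> permutations_of_set A"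
  by (simp add: splits_21_def)

text \<open>
  For \<open>i \<ge> 3\<close> write \<open>G i\<close> as the reduced relation plus multiples of the commutator. The leading
  word of each of these is an arrangement of the letters other than \<open>i\<close>.
\<close>

lemma G_in_lower_2b:
  assumes i: "i \<in> D" and Yi: "3 \<le> i \<Longrightarrow> Y i = 0"
    and less: "\<And>w. w \<in> permutations_of_set (D - {i}) \<Longrightarrow> a @ w @ b \<prec> W"
  shows "mon a * G i * mon b \<in> lower_2b W"
proof -
  have word: "mon a * gen_2b (word_2b i) * mon b \<in> lower_2b W"
    using i less[OF word_2b_perm] by (intro word_system.lower_base) (simp_all add: forbidden_2b_eq)
  show ?thesis
  proof (cases "i \<le> 2")
    case True
    then show ?thesis using word gen_2b_word[OF i] by simp
  next
    case False
    define s where "s = (\<Sum>(c, d)\<in>splits_21 (D - {i}).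
      scl (\<sigma> * of_int (word_sign (c @ [2, 1] @ d))) (mon c * comm_21 * mon d))"
    have "G i = - reduced_G i + s" unfolding s_def using False Yi by (intro G_reduced) simp
    also have "reduced_G i = gen_2b (word_2b i)" using False gen_2b_word[OF i] by simp
    finally have Gi: "G i = - gen_2b (word_2b i) + s" .
    have "mon a * G i * mon b = - (mon a * gen_2b (word_2b i) * mon b) + mon a * s * mon b"
      unfolding Gi by (simp add: algebra_simps)
    also have "\<dots> \<in> lower_2b W"
    proof (intro P.subspace_add[OF lower_2b_subspace] P.subspace_neg[OF lower_2b_subspace] word,
          unfold s_def, rule comm_in_lower_2b)
      fix c d assume "(c, d) \<in> splits_21 (D - {i})"
      from less[OF splits_21_perm[OF this]] show "(a @ c) @ [2, 1] @ (d @ b) \<prec> W" by simp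
    qed
    finally show ?thesis .
  qed
qed

lemma full_word_21: "full_word = (n + 1) # rev [3..<n+1] @ [2, 1]"
proof -
  have "[1..<n+1] = [1, 2] @ [3..<n+1]" using n by (simp add: upt_conv_Cons eval_nat_numeral del: upt_Suc)
  then show ?thesis unfolding full_word_eq(1) by (simp del: upt_Suc)
qed

text \<open>
  Exactly one term of \<open>x\<^sub>n\<^sub>+\<^sub>1 G\<^sub>n\<^sub>+\<^sub>1\<close> has the full word as its leading word: the multiple of the
  commutator at the end of that word.
\<close>

lemma last_G_2b:
  assumes "Y (n + 1) = 0"
  shows "mon [n+1] * G (n+1) - mon (rev [3..<n+2]) * comm_21 \<in> lower_2b full_word"
proof -
  let ?i = "n + 1" and ?c = "rev [3..<n+1]"
  let ?T = "splits_21 (D - {?i})"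
  let ?k = "\<lambda>c d. \<sigma> * of_int (word_sign (c @ [2, 1] @ d))"
  let ?f = "\<lambda>(c, d). scl (?k c d) (mon c * comm_21 * mon d)"
  have i: "?i \<in> D" "3 \<le> ?i" using n by auto
  have "[1..<n+2] = [1..<n+1] @ [n+1]" by simp
  moreover have "filter (\<lambda>j. j \<noteq> n + 1) [1..<n+1] = [1..<n+1]" by (auto simp: filter_id_conv simp del: upt_Suc)
  ultimately have "omit n ?i = [1..<n+1]" unfolding omit_def by simp
  moreover have "[1..<n+1] = [1, 2] @ [3..<n+1]" using n by (simp add: upt_conv_Cons eval_nat_numeral del: upt_Suc)
  ultimately have desc: "rev (omit n ?i) = ?c @ [2, 1] @ []" by simp
  have cT: "(?c, []) \<in> ?T" using desc_in_perms[of ?i] unfolding desc splits_21_def by blast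
  have k: "?k ?c [] = 1" using word_sign_desc[OF i(1)] unfolding desc by (simp add: \<sigma>_square)
  have "finite ?T" by (intro finite_splits_21) simp
  from sum.remove[OF this cT, of ?f] have "sum ?f ?T = mon ?c * comm_21 + sum ?f (?T - {(?c, [])})"
    unfolding k prod.case by (simp add: mon_Nil)
  then have G: "G ?i = - reduced_G ?i + (mon ?c * comm_21 + sum ?f (?T - {(?c, [])}))"
    using G_reduced[OF assms] by simp
  have "rev [3..<n+2] = ?i # ?c" using n by simp
  then have M: "mon (rev [3..<n+2]) = mon [?i] * mon ?c" by (simp add: mon_mult)
  have R: "reduced_G ?i = gen_2b (word_2b ?i)" using gen_2b_word[OF i(1)] i(2) by simp
  define r where "r = sum ?f (?T - {(?c, [])})"
  have "mon [?i] * G ?i - mon (rev [3..<n+2]) * comm_21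
      = - (mon [?i] * gen_2b (word_2b ?i) * mon []) + mon [?i] * r * mon []"
    unfolding G r_def[symmetric] M R by (simp add: algebra_simps mon_Nil del: upt_Suc)
  also have "\<dots> \<in> lower_2b full_word"
  proof (intro P.subspace_add[OF lower_2b_subspace] P.subspace_neg[OF lower_2b_subspace])
    have perm: "?i # w \<in> permutations_of_set D" if "w \<in> permutations_of_set (D - {?i})" for w
      using permutations_of_set_extend(1)[OF that i(1)] .
    have "word_2b ?i \<noteq> ?c @ [2, 1]"
      using nonadjacent_word_2b[OF i(2)] adjacent_12_append(2)[of ?c "[]"] by auto
    then have "[?i] @ word_2b ?i @ [] \<prec> full_word"
      using perm[OF word_2b_perm] by (intro perm_less_full) (simp_all add: full_word_21 del: upt_Suc)
    then show "mon [?i] * gen_2b (word_2b ?i) * mon [] \<in> lower_2b full_word"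
      using i by (intro word_system.lower_base) (simp_all add: forbidden_2b_eq)
    show "mon [?i] * r * mon [] \<in> lower_2b full_word"
      unfolding r_def
    proof (rule comm_in_lower_2b)
      fix c d assume cd: "(c, d) \<in> ?T - {(?c, [])}"
      then have p: "c @ [2, 1] @ d \<in> permutations_of_set (D - {?i})" by (simp add: splits_21_def)
      have "c @ [2, 1] @ d \<noteq> ?c @ [2, 1]"
      proof
        assume eq: "c @ [2, 1] @ d = ?c @ [2, 1]"
        have "2 \<notin> set c" "2 \<notin> set (1 # d)" using p by (auto simp: permutations_of_set_def)
        from append_Cons_eq_iff[OF this, of ?c "[1]"] eq have "c = ?c" "d = []" by simp_all
        then show False using cd by simp
      qed
      then show "([?i] @ c) @ [2, 1] @ (d @ []) \<prec> full_word"
        using perm[OF p] by (intro perm_less_full) (simp_all add: full_word_21 del: upt_Suc)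
    qed
  qed
  finally show ?thesis .
qed

text \<open>
  The composition of \<open>x\<^sub>n\<^sub>+\<^sub>1 \<dots> x\<^sub>2\<close> and \<open>x\<^sub>2 x\<^sub>1\<close> is \<open>G\<^sub>1 x\<^sub>1 - x\<^sub>n\<^sub>+\<^sub>1 \<dots> x\<^sub>3 [x\<^sub>2, x\<^sub>1]\<close>. The product
  \<open>x\<^sub>n\<^sub>+\<^sub>1 G\<^sub>n\<^sub>+\<^sub>1\<close> lies between its two terms: the difference to the first one is treated by
  \<open>composition_in_subspace\<close>, the difference to the second one by \<open>last_G_2b\<close>.
\<close>

lemma system_2b:
  assumes Y0: "\<And>i. i \<in> D \<Longrightarrow> 3 \<le> i \<Longrightarrow> Y i = 0" and comm: "commutators = scl \<beta> comm_21"
  shows "confluent_word_system S2b gen_2b"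
proof
  show "v \<prec> u" if "u \<in> S2b" "v \<in> Poly_Mapping.keys (gen_2b u - mon u)" for u v
    using leading_2b that by blast
  show "v = u" if "u \<in> S2b" "v \<in> S2b" "sublist v u" for u v
    using factor_free_2b that by blast
  show "gen_2b (p @ y) * mon z - mon p * gen_2b (y @ z) \<in> lower_2b (p @ y @ z)"
    if h: "p @ y \<in> S2b" "y @ z \<in> S2b" "p \<noteq> []" "y \<noteq> []" "z \<noteq> []" for p y z
  proof -
    have pyz: "p = rev [3..<n+2]" "y = [2]" "z = [1]" using overlap_2b h by blast+
    have up: "[2..<n+2] = 2 # [3..<n+2]" using n by (simp add: upt_conv_Cons eval_nat_numeral del: upt_Suc)
    have one: "1 \<in> D" by simp
    have "rev (omit n 1) = rev [3..<n+2] @ [2]" unfolding omit_1_2(1) up by simp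
    then have py: "p @ y = word_2b 1" by (simp add: pyz word_2b_def del: upt_Suc)
    have full: "p @ y @ z = full_word" unfolding full_word_eq(2) up by (simp add: pyz del: upt_Suc)
    have "[2, 1] \<prec> full_word" using n by (simp add: word_less_def lenlex_conv full_word_def del: upt_Suc)
    then have "mon [] * gen_2b [2, 1] * mon [] \<in> lower_2b full_word"
      by (intro word_system.lower_base) (simp_all add: forbidden_2b_eq)
    then have C: "commutators \<in> lower_2b full_word"
      using P.subspace_scale[OF lower_2b_subspace] by (simp add: comm mon_Nil gen_2b_21)
    have "G 1 * mon [1] - mon [n+1] * G (n+1) \<in> lower_2b full_word"
    proof (rule composition_in_subspace[OF lower_2b_subspace _ _ C])
      fix i assume i: "i \<in> D"
      show "mon [i] * G i \<in> lower_2b full_word" if "i \<le> n"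
        using G_in_lower_2b[OF i Y0[OF i], of "[i]" "[]" full_word] word_less_full(1)[OF _ i that]
        by (simp add: mon_Nil)
      show "G i * mon [i] \<in> lower_2b full_word" if "2 \<le> i"
        using G_in_lower_2b[OF i Y0[OF i], of "[]" "[i]" full_word] word_less_full(2)[OF _ i that]
        by (simp add: mon_Nil)
    qed
    moreover have "mon [n+1] * G (n+1) - mon p * comm_21 \<in> lower_2b full_word"
      unfolding pyz using n by (intro last_G_2b Y0) auto
    ultimately have "(G 1 * mon [1] - mon [n+1] * G (n+1)) + (mon [n+1] * G (n+1) - mon p * comm_21)
        \<in> lower_2b full_word" by (rule P.subspace_add[OF lower_2b_subspace])
    moreover have "gen_2b (p @ y) = G 1" unfolding py using gen_2b_word[OF one] by simp
    moreover have "gen_2b (y @ z) = comm_21" by (simp add: pyz gen_2b_21)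
    ultimately show ?thesis unfolding full by (simp add: pyz(3))
  qed
qed

text \<open>
  The commutator lies in the ideal because the obstruction is a nonzero multiple of it; the reduced
  relations differ from the generators by multiples of the commutator.
\<close>

lemma multiples_2b:
  assumes Y0: "\<And>i. i \<in> D \<Longrightarrow> 3 \<le> i \<Longrightarrow> Y i = 0" and comm: "commutators = scl \<beta> comm_21"
    and "\<beta> \<noteq> 0"
  shows "multiples D (gen_2b ` S2b) = multiples D (G ` D)"
proof (rule multiples_eqI)
  let ?s = "\<lambda>i. \<Sum>(c, d)\<in>splits_21 (D - {i}).
      scl (\<sigma> * of_int (word_sign (c @ [2, 1] @ d))) (mon c * comm_21 * mon d)"
  have base: "f \<in> multiples D H" if "f \<in> H" for f :: "nat list \<Rightarrow>\<^sub>0 'a" and H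
    using multiples_base[OF that, of "[]" D "[]"] by (simp add: mon_Nil)
  have s: "?s i \<in> multiples D H" if "comm_21 \<in> multiples D H" for i H
  proof (intro P.subspace_sum[OF multiples_subspace], clarify)
    fix c d assume "(c, d) \<in> splits_21 (D - {i})"
    then have "set (c @ [2, 1] @ d) \<subseteq> D" unfolding splits_21_def permutations_of_set_def by blast
    then have "set c \<subseteq> D" "set d \<subseteq> D" by (simp_all only: set_append Un_subset_iff)
    then show "scl (\<sigma> * of_int (word_sign (c @ [2, 1] @ d))) (mon c * comm_21 * mon d) \<in> multiples D H"
      by (intro P.subspace_scale[OF multiples_subspace] multiples_mon_mult that)
  qed
  have G: "G i = - reduced_G i + ?s i" if "i \<in> D" "3 \<le> i" for i
    using that Y0 by (intro G_reduced) simp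
  have "scl (inverse \<beta>) commutators = comm_21" using \<open>\<beta> \<noteq> 0\<close> by (simp add: comm)
  then have C: "comm_21 \<in> multiples D (G ` D)"
    using P.subspace_scale[OF multiples_subspace commutators_multiple] by metis
  show "gen_2b ` S2b \<subseteq> multiples D (G ` D)"
  proof clarify
    fix w assume "w \<in> S2b"
    then consider "w = [2, 1]" | i where "i \<in> D" "w = word_2b i" unfolding forbidden_2b_eq by blast
    then show "gen_2b w \<in> multiples D (G ` D)"
    proof cases
      case 1 then show ?thesis using C by (simp add: gen_2b_def)
    next
      case (2 i)
      show ?thesis
      proof (cases "i \<le> 2")
        case True then show ?thesis using 2 gen_2b_word[OF 2(1)] base[of "G i" "G ` D"] by simp
      next
        case False
        then have "gen_2b w = ?s i - G i" using 2 G[of i] gen_2b_word[OF 2(1)] by simp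
        then show ?thesis using P.subspace_diff[OF multiples_subspace s[OF C] base] 2(1) by simp
      qed
    qed
  qed
  show "G ` D \<subseteq> multiples D (gen_2b ` S2b)"
  proof clarify
    fix i assume i: "i \<in> D"
    have w: "gen_2b (word_2b i) \<in> multiples D (gen_2b ` S2b)"
      using i by (intro base imageI) (simp add: forbidden_2b_eq)
    show "G i \<in> multiples D (gen_2b ` S2b)"
    proof (cases "i \<le> 2")
      case True then show ?thesis using w gen_2b_word[OF i] by simp
    next
      case False
      have "gen_2b [2, 1] \<in> multiples D (gen_2b ` S2b)"
        by (intro base imageI) (simp add: forbidden_2b_eq)
      then have "?s i \<in> multiples D (gen_2b ` S2b)" by (intro s) (simp only: gen_2b_21)
      moreover have "G i = - gen_2b (word_2b i) + ?s i" using False G[of i] i gen_2b_word[OF i] by simp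
      ultimately show ?thesis
        using P.subspace_add[OF multiples_subspace P.subspace_neg[OF multiples_subspace w]] by simp
    qed
  qed
qed

end


section \<open>Bases of the envelope\<close>

lemma (in even_envelope) G_in_free_alg: "G ` D \<subseteq> carrier (free_alg (n + 1))"
proof clarify
  fix i assume i: "i \<in> D"
  let ?w = "rev (omit n i)"
  have "G i - mon ?w \<in> carrier (free_alg (n + 1))"
    unfolding carrier_free_alg using leading_G[OF i] by blast
  moreover have "set ?w \<subseteq> D" unfolding set_rev set_omit by blast
  then have "mon ?w \<in> carrier (free_alg (n + 1))" by (rule mon_in_free_alg)
  ultimately have "(G i - mon ?w) + mon ?w \<in> carrier (free_alg (n + 1))"
    unfolding carrier_free_alg_eq_span by (rule P.span_add)
  then show "G i \<in> carrier (free_alg (n + 1))" by simp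
qed

lemma monomial_basis_if_confluent:
  assumes ideal: "env_ideal scale n br e = multiples {1..n+1} (g ` S)"
    "ideal (env_ideal scale n br e) (free_alg (n + 1))"
    and "confluent_word_system S g"
    and lead: "\<And>u v. u \<in> S \<Longrightarrow> v \<in> Poly_Mapping.keys (g u - mon u) \<Longrightarrow> v \<prec> u \<and> set v \<subseteq> {1..n+1}"
  shows "monomial_basis scale n br e (avoiding n S)"
proof -
  interpret confluent_word_system S g by fact
  interpret Q: free_alg_ideal "n + 1" "env_ideal scale n br e" by (rule free_alg_ideal.intro) (rule ideal(2))
  let ?W = "avoiding n S"
  have sub: "?W \<subseteq> {w. set w \<subseteq> {1..n+1}}" by (auto simp: avoiding_def)
  have ind: "f = 0" if "f \<in> env_ideal scale n br e" "Poly_Mapping.keys f \<subseteq> ?W" for f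
    using that(1) unfolding ideal(1)
    by (rule normal_eq_zero_if_multiple) (use that(2) in \<open>auto simp: avoiding_def\<close>)
  have gen: "mon w \<in> P.span (mon ` ?W \<union> env_ideal scale n br e)" if "set w \<subseteq> {1..n+1}" for w
    using normal_words_span[OF lead that] unfolding ideal(1) avoiding_def by simp
  have "mon_coset scale n br e = (\<lambda>w. Q.coset (mon w))"
    unfolding mon_coset_def Q.coset_def ..
  then show ?thesis
    using Q.monomials_basis[OF sub ind gen] unfolding monomial_basis_def envelope_eq by simp
qed

lemma not_fin_dim_if_infinite_basis:
  assumes "ideal (env_ideal scale n br e) (free_alg (n + 1))"
    and "monomial_basis scale n br e W" and "infinite W"
  shows "\<not> vectorspace.fin_dim class_ring (envelope scale n br e)"
proof -
  interpret Q: free_alg_ideal "n + 1" "env_ideal scale n br e" by (rule free_alg_ideal.intro) (rule assms(1))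
  interpret V: vectorspace class_ring "envelope scale n br e"
    unfolding envelope_eq by (rule Q.vectorspace_V)
  have "infinite (mon_coset scale n br e ` W)"
    using assms(2,3) finite_imageD unfolding monomial_basis_def by blast
  then show ?thesis
    using assms(2) V.fin_dim_li_fin unfolding monomial_basis_def V.basis_def by blast
qed

text \<open>
  The powers of the first letter have no factor with two different letters.
\<close>

lemma infinite_avoiding:
  assumes "\<And>u. u \<in> S \<Longrightarrow> distinct u \<and> 2 \<le> length u"
  shows "infinite (avoiding n S)"
proof -
  have "replicate k 1 \<in> avoiding n S" for k
  proof -
    have False if "u \<in> S" "sublist u (replicate k 1)" for u
    proof -
      have "set u \<subseteq> {1}" using set_mono_sublist[OF that(2)] by (auto split: if_splits)
      then have "card (set u) \<le> card {1::nat}" by (intro card_mono) simp_all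
      then show False using assms[OF that(1)] by (simp add: distinct_card)
    qed
    then show ?thesis by (auto simp: avoiding_def)
  qed
  then have "range (\<lambda>k. replicate k 1) \<subseteq> avoiding n S" by blast
  moreover have "inj (\<lambda>k. replicate k (1::nat))" by (rule injI) (metis length_replicate)
  ultimately show ?thesis using range_inj_infinite infinite_super by blast
qed

context n_Lie_algebra
begin

lemma phi_basis:
  assumes "indexed_basis e"
  shows "phi scale n e 0 = 0" "j \<in> {1..n+1} \<Longrightarrow> phi scale n e (e j) = mon [j]"
    "phi scale n e (u + v) = phi scale n e u + phi scale n e v"
    "phi scale n e (scale c v) = scl c (phi scale n e v)"
proof -
  have e: "inj_on e {1..n+1}" "independent (e ` {1..n+1})" "\<And>v. v \<in> span (e ` {1..n+1})"
    using assms by (auto simp: indexed_basis_def)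
  show "phi scale n e 0 = 0" by (simp add: phi_def representation_zero const_hom)
  show "phi scale n e (u + v) = phi scale n e u + phi scale n e v"
    using e(2,3) by (simp add: phi_def representation_add const_hom distrib_right sum.distrib del: sum.cl_ivl_Suc)
  show "phi scale n e (scale c v) = scl c (phi scale n e v)"
    using e(2,3) by (simp add: phi_def representation_scale const_hom scl_def sum_distrib_left mult.assoc del: sum.cl_ivl_Suc)
  show "phi scale n e (e j) = mon [j]" if j: "j \<in> {1..n+1}"
  proof -
    have "phi scale n e (e j) = (\<Sum>i=1..n+1. if i = j then mon [i] else 0)"
      unfolding phi_def
    proof (intro sum.cong refl)
      fix i assume i: "i \<in> {1..n+1}"
      have "representation (e ` {1..n+1}) (e j) (e i) = (if e i = e j then 1 else 0)"
        using representation_basis[OF e(2), of "e j"] j by simp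
      also have "e i = e j \<longleftrightarrow> i = j" using e(1) i j by (simp only: inj_on_eq_iff)
      finally show "const (representation (e ` {1..n+1}) (e j) (e i)) * mon [i] = (if i = j then mon [i] else 0)"
        by (simp add: const_hom)
    qed
    then show ?thesis using j by (simp del: sum.cl_ivl_Suc)
  qed
qed

definition table_poly :: "(nat \<Rightarrow> 'l) \<Rightarrow> nat \<Rightarrow> (nat list \<Rightarrow>\<^sub>0 'a)" where
  "table_poly e i = phi scale n e (br (map e (omit n i)))"

lemma even_envelope_table:
  assumes "even n" "n \<ge> 4"
  shows "even_envelope n (table_poly e)"
proof
  fix i assume "i \<in> {1..n+1}"
  show "table_poly e i \<in> P.span (mon ` {[j] |j. j \<in> {1..n+1}})"
    unfolding table_poly_def phi_def scl_def[symmetric]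
    by (intro P.span_sum P.span_scale P.span_base) blast
qed (use assms in auto)

lemma env_ideal_eq:
  assumes "even n" "n \<ge> 4"
  shows "env_ideal scale n br e = multiples {1..n+1} (even_envelope.G n (table_poly e) ` {1..n+1})"
    and "ideal (env_ideal scale n br e) (free_alg (n + 1))"
proof -
  interpret even_envelope n "table_poly e" using assms by (rule even_envelope_table)
  have "env_gen scale n br e i = G i" for i
    unfolding env_gen_def minus_one_power_mult_scl alt_eq_alt_sum[OF strict_sorted_omit] set_omit
      G_def \<sigma>_def table_poly_def ..
  then have "env_gen scale n br e ` D = G ` D" by simp
  then have *: "env_ideal scale n br e = multiples D (G ` D)"
    unfolding env_ideal_def by (simp only: genideal_eq_multiples[OF G_in_free_alg])
  then show "env_ideal scale n br e = multiples D (G ` D)" .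
  show "ideal (env_ideal scale n br e) (free_alg (n + 1))"
    unfolding * by (rule ideal_multiples[OF G_in_free_alg])
qed

lemma descending_basis:
  assumes n: "even n" "n \<ge> 4" and e: "indexed_basis e"
    and t: "bracket_table n br e t" "\<And>i. i \<in> {1..n+1} \<Longrightarrow> t i = 0 \<or> t i = e i"
  shows "monomial_basis scale n br e (avoiding n (descending n))"
proof -
  interpret even_envelope n "table_poly e" using n by (rule even_envelope_table)
  have "table_poly e i = 0 \<or> table_poly e i = mon [i]" if "i \<in> D" for i
    using t(1) t(2)[OF that] phi_basis(1)[OF e] phi_basis(2)[OF e that] that
    by (auto simp: bracket_table_def table_poly_def)
  then have comm: "commutators = 0"
    unfolding commutators_def by (intro sum.neutral) fastforce
  have "confluent_word_system (descending n \<union> {}) gen_desc" by (rule descending_system) (simp add: comm)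
  moreover have "env_ideal scale n br e = multiples D (gen_desc ` (descending n \<union> {}))"
    using descending_multiples[of "{}"] env_ideal_eq(1)[OF n, of e] by simp
  ultimately show ?thesis
    using descending_leading[of _ "{}"] env_ideal_eq(2)[OF n, of e]
    by (intro monomial_basis_if_confluent[where g = gen_desc]) auto
qed

lemma form_1b_basis:
  assumes n: "even n" "n \<ge> 4" and e: "indexed_basis e" and t: "form_1b n br e"
  shows "monomial_basis scale n br e (avoiding n (forbidden_1b n))"
proof -
  interpret even_envelope n "table_poly e" using n by (rule even_envelope_table)
  have Y: "table_poly e i = (if i = n + 1 then mon [1] else 0)" if "i \<in> D" for i
    using t phi_basis(1)[OF e] phi_basis(2)[OF e, of 1] that
    by (simp add: form_1b_def bracket_table_def table_poly_def)
  have "commutators = (\<Sum>i\<in>D. if i = n + 1 then - (mon [n+1, 1] - mon [1, n+1]) else 0)"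
    unfolding commutators_def
    by (intro sum.cong refl) (use n in \<open>simp add: Y mon_mult P.scale_minus_left\<close>)
  then have comm: "commutators = - (mon [n+1, 1] - mon [1, n+1])" by (simp del: sum.cl_ivl_Suc)
  let ?S = "descending n \<union> {[n+1, 1]}"
  have "confluent_word_system ?S gen_desc" by (rule descending_system) (simp add: comm)
  moreover have "env_ideal scale n br e = multiples D (gen_desc ` ?S)"
    using descending_multiples[of "{[n+1, 1]}"] env_ideal_eq(1)[OF n, of e] comm by simp
  moreover have "forbidden_1b n = ?S" by (auto simp: forbidden_1b_def)
  ultimately show ?thesis
    using descending_leading[of _ "{[n+1, 1]}"] env_ideal_eq(2)[OF n, of e]
    by (simp only:) (intro monomial_basis_if_confluent[where g = gen_desc], auto)
qed

lemma form_2b_basis: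
  assumes n: "even n" "n \<ge> 4" and e: "indexed_basis e" and t: "form_2b scale n br e"
  shows "monomial_basis scale n br e (avoiding n (forbidden_2b n))"
proof -
  interpret even_envelope n "table_poly e" using n by (rule even_envelope_table)
  obtain \<beta> where \<beta>: "\<beta> \<noteq> 0" and
    tab: "bracket_table n br e (\<lambda>i. if i = 1 then e 1 + scale \<beta> (e 2) else if i = 2 then e 2 else 0)"
    using t by (auto simp: form_2b_def)
  have Y: "table_poly e i = (if i = 1 then mon [1] + scl \<beta> (mon [2]) else if i = 2 then mon [2] else 0)"
    if "i \<in> D" for i
    using tab phi_basis[OF e] that n by (simp add: bracket_table_def table_poly_def)
  have "commutators = (\<Sum>i\<in>D. if i = 1 then scl \<beta> comm_21 else 0)"
    unfolding commutators_def
    by (intro sum.cong refl)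
      (auto simp: Y mon_mult P.scale_minus_left comm_21_def mult_scl distrib_left distrib_right
        P.scale_right_diff_distrib)
  then have comm: "commutators = scl \<beta> comm_21" by (simp del: sum.cl_ivl_Suc)
  have Y0: "table_poly e i = 0" if "i \<in> D" "3 \<le> i" for i using Y that by simp
  show ?thesis
  proof (rule monomial_basis_if_confluent[where g = gen_2b])
    show "confluent_word_system S2b gen_2b" by (rule system_2b[OF Y0 comm])
    show "env_ideal scale n br e = multiples D (gen_2b ` S2b)"
      using env_ideal_eq(1)[OF n, of e] multiples_2b[OF Y0 comm \<beta>] by simp
  qed (use leading_2b env_ideal_eq(2)[OF n] in auto)
qed

end

lemma forbidden_words_distinct:
  assumes "even n" "n \<ge> 4" "u \<in> descending n \<or> u \<in> forbidden_1b n \<or> u \<in> forbidden_2b n"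
  shows "distinct u \<and> 2 \<le> length u"
proof -
  \<comment> \<open>The facts about words do not depend on the field or on \<open>Y\<close>.\<close>
  interpret even_envelope n "\<lambda>i. 0 :: nat list \<Rightarrow>\<^sub>0 rat"
    using assms(1,2) by unfold_locales (simp_all add: P.span_zero)
  have "distinct u \<and> 2 \<le> length u" if "u \<in> descending n" for u
    using that n descending_distinct[of u] by (auto simp: descending_def)
  moreover have "distinct (word_2b i) \<and> 2 \<le> length (word_2b i)" if "i \<in> D" for i
    using word_2b(2) length_word_2b[OF that] n by simp
  ultimately show ?thesis
    using assms(3) n unfolding forbidden_1b_def forbidden_2b_eq by auto
qed

theorem corollary5p8:
  fixes scale :: "'a::{alg_closed_field, field_char_0} \<Rightarrow> 'l::ab_group_add \<Rightarrow> 'l"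
    and br :: "'l list \<Rightarrow> 'l" and e :: "nat \<Rightarrow> 'l" and n :: nat
  assumes "n \<ge> 4" and "even n"
    and "n_Lie_algebra scale n br"
    and "\<not> n_Lie_algebra.simple scale n br"
    and "n_Lie_algebra.indexed_basis scale n e"
    and "form_0 n br e \<or> form_1a n br e \<or> form_1b n br e \<or> form_2a n br e \<or> form_2b scale n br e \<or>
           (\<exists>r\<in>{3..n}. form_r n br e r)"
  shows "(form_0 n br e \<or> form_1a n br e \<or> form_2a n br e \<or> (\<exists>r\<in>{3..n}. form_r n br e r) \<longrightarrow>
            monomial_basis scale n br e (avoiding n (descending n))) \<and>
         (form_1b n br e \<longrightarrow> monomial_basis scale n br e (avoiding n (forbidden_1b n))) \<and>
         (form_2b scale n br e \<longrightarrow> monomial_basis scale n br e (avoiding n (forbidden_2b n))) \<and>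
         \<not> vectorspace.fin_dim class_ring (envelope scale n br e)"
proof -
  interpret n_Lie_algebra scale n br by fact
  note hyps = assms(2,1,5)
  have std: "monomial_basis scale n br e (avoiding n (descending n))"
    if "form_0 n br e \<or> form_1a n br e \<or> form_2a n br e \<or> (\<exists>r\<in>{3..n}. form_r n br e r)"
  proof -
    from that obtain t where "bracket_table n br e t" "\<And>i. t i = 0 \<or> t i = e i"
      unfolding form_0_def form_1a_def form_2a_def form_r_def by force
    then show ?thesis using descending_basis[OF hyps] by blast
  qed
  note bases = std form_1b_basis[OF hyps] form_2b_basis[OF hyps]
  have "infinite (avoiding n (descending n))" "infinite (avoiding n (forbidden_1b n))"
    "infinite (avoiding n (forbidden_2b n))"
    using infinite_avoiding forbidden_words_distinct[OF assms(2,1)] by blast+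
  then have "\<not> vectorspace.fin_dim class_ring (envelope scale n br e)"
    using bases assms(6) not_fin_dim_if_infinite_basis[OF env_ideal_eq(2)[OF assms(2,1)]] by blast
  with bases show ?thesis by blast
qed

end
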